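(* Let $G$ be a connected graph with minimum degree $\delta(G)\geq 1$, and let $H$ be a connected graph with maximum degree $\Delta(H)$. Assume that the following conditions hold: (1) if $G$ is regular, then $H$ is not isomorphic to $G$; (2) if $G$ is isomorphic to $K_{\delta(G)+1}$, then $H$ is not isomorphic to $K_{k\delta(G)+1}$ for any positive integer $k$; (3) if $G$ is isomorphic to $K_2$, then $H$ is neither an odd cycle nor a complete graph. Then there is a $G$-free $\left\lceil \frac{\Delta(H)}{\delta(G)}\right\rceil$-coloring of $H$ one of whose color classes is a maximum induced $G$-free subgraph in $H$ (that is, this color class has the largest cardinality among all sets $W\subseteq V(H)$ such that $H[W]$ is $G$-free). In particular, \[\chi_{G}(H)\leq\left\lceil \frac{\Delta(H)}{\delta(G)}\right\rceil .\]
   Context: All graphs are finite and simple. $H[W]$ denotes the subgraph of $H$ induced on $W\subseteq V(H)$. A graph is $G$-free if it contains no subgraph (not necessarily induced) isomorphic to $G$. A $G$-free $k$-coloring of $H$ is a map $c:V(H)\to\{1,\ldots,k\}$ such that the subgraph of $H$ induced on each color class $c^{-1}(i)$ is $G$-free. The $G$-free chromatic number $\chi_G(H)$ is the minimum $k$ for which $H$ has a $G$-free $k$-coloring. $K_n$ is the complete graph on $n$ vertices.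
   Formalization: The maximum degree of H is assumed to be at least 1, which excludes only the one-vertex graph H; there the claim is false as stated (e.g. G the path on three vertices), since the ceiling is 0 and a nonempty graph has no 0-coloring. *)

theory Defs
  imports Complex_Main "Graph_Theory.Graph_Theory"
begin

text \<open>
  Finite simple graphs are modelled by the locale \<^locale>\<open>pair_graph\<close>: a finite vertex set
  together with a finite, symmetric, irreflexive relation. An undirected edge is thus a pair of
  opposite arcs, and the degree of a vertex is its \<^const>\<open>out_degree\<close>.
\<close>

definition min_degree :: "('a, 'b) pre_digraph \<Rightarrow> nat" where
  "min_degree G = Min (out_degree G ` verts G)"

definition max_degree :: "('a, 'b) pre_digraph \<Rightarrow> nat" where
  "max_degree G = Max (out_degree G ` verts G)"

definition regular_graph :: "('a, 'b) pre_digraph \<Rightarrow> bool" where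
  "regular_graph G \<longleftrightarrow> (\<exists>d. \<forall>v \<in> verts G. out_degree G v = d)"

definition cycle_graph :: "nat \<Rightarrow> nat pair_pre_digraph" where
  "cycle_graph n = \<lparr> pverts = {0..<n},
     parcs = {(i, j). i < n \<and> j < n \<and> (j = (i + 1) mod n \<or> i = (j + 1) mod n)} \<rparr>"

definition odd_cycle :: "('a, 'b) pre_digraph \<Rightarrow> bool" where
  "odd_cycle H \<longleftrightarrow> (\<exists>n \<ge> 3. odd n \<and> digraph_iso (with_proj (cycle_graph n)) H)"

definition graph_free :: "('a, 'b) pre_digraph \<Rightarrow> ('c, 'd) pre_digraph \<Rightarrow> bool" where
  "graph_free G H \<longleftrightarrow> \<not> (\<exists>S. subgraph S H \<and> digraph_iso G S)"

definition color_class :: "('c, 'd) pre_digraph \<Rightarrow> ('c \<Rightarrow> nat) \<Rightarrow> nat \<Rightarrow> 'c set" where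
  "color_class H c i = {v \<in> verts H. c v = i}"

definition free_coloring ::
    "('a, 'b) pre_digraph \<Rightarrow> ('c, 'd) pre_digraph \<Rightarrow> nat \<Rightarrow> ('c \<Rightarrow> nat) \<Rightarrow> bool" where
  "free_coloring G H k c \<longleftrightarrow>
     c ` verts H \<subseteq> {1..k} \<and> (\<forall>i \<in> {1..k}. graph_free G (H \<restriction> color_class H c i))"

definition free_chromatic_number ::
    "('a, 'b) pre_digraph \<Rightarrow> ('c, 'd) pre_digraph \<Rightarrow> nat" where
  "free_chromatic_number G H = (LEAST k. \<exists>c. free_coloring G H k c)"

definition maximum_free_set ::
    "('a, 'b) pre_digraph \<Rightarrow> ('c, 'd) pre_digraph \<Rightarrow> 'c set \<Rightarrow> bool" where
  "maximum_free_set G H W \<longleftrightarrow>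
     W \<subseteq> verts H \<and> graph_free G (H \<restriction> W) \<and>
     (\<forall>W'. W' \<subseteq> verts H \<and> graph_free G (H \<restriction> W') \<longrightarrow> card W' \<le> card W)"

text \<open>
  A nonempty graph has no coloring with zero colors, so a bound by
  the rounded-up quotient of maximum and minimum degree is impossible for an edgeless \<open>H\<close>.
\<close>

lemma free_coloring_0_iff: "free_coloring G H 0 c \<longleftrightarrow> verts H = {}"
  by (simp add: free_coloring_def)

end

theory Submission
  imports Defs
begin

text \<open>
  Write \<open>\<delta>\<close> for the minimum degree of \<open>G\<close> and let \<open>k\<close> be the number of colours. If \<open>k = 1\<close>, a copy of \<open>G\<close> in
  \<open>H\<close> would be all of \<open>H\<close>, and \<open>G\<close> regular. If \<open>k = 2\<close> and \<open>G\<close> is a single edge, \<open>H\<close> is a path or an even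
  cycle. Otherwise put \<open>r = (k - 1) \<delta>\<close>. Every vertex outside a maximum \<open>G\<close>-free set \<open>S\<close> has at least \<open>\<delta>\<close>
  neighbours in \<open>S\<close>, hence at most \<open>r\<close> outside, and \<open>H - S\<close> can be coloured greedily with \<open>k - 1\<close> colours
  unless it has an \<open>r\<close>-regular component. Choose \<open>S\<close> with the fewest such components (not counting
  complete ones when \<open>G\<close> is not complete). If \<open>C\<close> is one of them, exchanging \<open>v \<in> C\<close> with a
  neighbour \<open>u \<in> S\<close> gives an equally good set, in which \<open>u\<close> lies in a new \<open>r\<close>-regular component.
  Repeating this with fresh vertices whose removal leaves the component connected, the walk must
  return to a remnant \<open>C - {v}\<close>. The returning vertex then has the same neighbours in \<open>C - {v}\<close> as
  \<open>v\<close>, and further exchanges show that \<open>C\<close> is complete and finally that \<open>H\<close> is complete.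
\<close>

section \<open>Connected sets and components\<close>

locale adjacency =
  fixes E :: "'v \<Rightarrow> 'v \<Rightarrow> bool"
  assumes E_sym: "E x y \<Longrightarrow> E y x"
    and E_irrefl: "\<not> E x x"
begin

definition nbhd :: "'v \<Rightarrow> 'v set \<Rightarrow> 'v set" where
  "nbhd x W = {y \<in> W. E x y}"

text \<open>As \<open>E\<close> is symmetric, these are the unions of components of the graph
  induced on \<open>W\<close>.\<close>

definition closed_in :: "'v set \<Rightarrow> 'v set \<Rightarrow> bool" where
  "closed_in W C \<longleftrightarrow> C \<subseteq> W \<and> (\<forall>x\<in>C. \<forall>y\<in>W. E x y \<longrightarrow> y \<in> C)"

text \<open>Connectedness without paths: the trace of a closed set on a subset is closed again, so
  the arguments below can work with closed sets alone.\<close>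

definition conn :: "'v set \<Rightarrow> bool" where
  "conn C \<longleftrightarrow> C \<noteq> {} \<and> (\<forall>A. A \<noteq> {} \<longrightarrow> closed_in C A \<longrightarrow> A = C)"

definition component :: "'v set \<Rightarrow> 'v set \<Rightarrow> bool" where
  "component W C \<longleftrightarrow> conn C \<and> closed_in W C"

definition clique :: "'v set \<Rightarrow> bool" where
  "clique Q \<longleftrightarrow> (\<forall>x\<in>Q. \<forall>y\<in>Q. x \<noteq> y \<longrightarrow> E x y)"

lemma in_nbhd [simp]: "y \<in> nbhd x W \<longleftrightarrow> y \<in> W \<and> E x y"
  by (simp add: nbhd_def)

lemma cliqueD: "clique Q \<Longrightarrow> x \<in> Q \<Longrightarrow> y \<in> Q \<Longrightarrow> x \<noteq> y \<Longrightarrow> E x y"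
  by (simp add: clique_def)

lemma finite_nbhd [simp]: "finite W \<Longrightarrow> finite (nbhd x W)"
  by (simp add: nbhd_def)

lemma card_nbhd_mono: "finite W \<Longrightarrow> A \<subseteq> W \<Longrightarrow> card (nbhd x A) \<le> card (nbhd x W)"
  by (rule card_mono) auto

lemma card_nbhd_Un:
  assumes "finite A" "finite B" "A \<inter> B = {}"
  shows "card (nbhd x (A \<union> B)) = card (nbhd x A) + card (nbhd x B)"
proof -
  have "nbhd x (A \<union> B) = nbhd x A \<union> nbhd x B" by auto
  moreover have "nbhd x A \<inter> nbhd x B = {}" using assms by auto
  ultimately show ?thesis using assms by (simp add: card_Un_disjoint)
qed

lemma connD: "conn C \<Longrightarrow> A \<noteq> {} \<Longrightarrow> closed_in C A \<Longrightarrow> A = C"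
  by (auto simp: conn_def)

lemma closed_inD: "closed_in W C \<Longrightarrow> x \<in> C \<Longrightarrow> y \<in> W \<Longrightarrow> E x y \<Longrightarrow> y \<in> C"
  by (simp add: closed_in_def)

lemma closed_in_subset: "closed_in W C \<Longrightarrow> C \<subseteq> A \<Longrightarrow> A \<subseteq> W \<Longrightarrow> closed_in A C"
  by (auto simp: closed_in_def)

lemma conn_subset_closed:
  assumes "conn D" "closed_in W C" "D \<subseteq> W" "D \<inter> C \<noteq> {}"
  shows "D \<subseteq> C"
proof -
  have "closed_in D (D \<inter> C)" using assms by (auto simp: closed_in_def)
  then have "D \<inter> C = D" using connD[OF assms(1), of "D \<inter> C"] assms(4) by simp
  then show ?thesis by blast
qed

lemma component_subset: "component W C \<Longrightarrow> C \<subseteq> W"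
  by (auto simp: component_def closed_in_def)

lemma component_closed: "component W C \<Longrightarrow> x \<in> C \<Longrightarrow> y \<in> W \<Longrightarrow> E x y \<Longrightarrow> y \<in> C"
  by (auto simp: component_def closed_in_def)

lemma component_eq:
  assumes "component W C" "component W D" "C \<inter> D \<noteq> {}"
  shows "C = D"
  using assms conn_subset_closed[of C W D] conn_subset_closed[of D W C]
  by (auto simp: component_def closed_in_def)

text \<open>The intersection of all closed sets containing \<open>x\<close> is the least of them. It
  is connected because, by symmetry, removing a closed part leaves a closed set, which minimality
  forbids.\<close>

lemma component_ex:
  assumes "x \<in> W"
  shows "\<exists>C. component W C \<and> x \<in> C"
proof -
  define C where "C = \<Inter>{C. closed_in W C \<and> x \<in> C}"
  have "closed_in W W" by (auto simp: closed_in_def)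
  then have "C \<subseteq> W" using assms by (auto simp: C_def)
  moreover have "b \<in> C" if ab: "a \<in> C" "b \<in> W" "E a b" for a b
  proof (unfold C_def, rule InterI)
    fix D assume D: "D \<in> {C. closed_in W C \<and> x \<in> C}"
    then have "a \<in> D" using ab(1) by (auto simp: C_def)
    then show "b \<in> D" using D ab by (auto simp: closed_in_def)
  qed
  ultimately have C: "closed_in W C" by (auto simp: closed_in_def)
  have xC: "x \<in> C" by (auto simp: C_def)
  have least: "C \<subseteq> D" if "closed_in W D" "x \<in> D" for D using that by (auto simp: C_def)
  have "A = C" if A: "A \<noteq> {}" "closed_in C A" for A
  proof (cases "x \<in> A")
    case True
    have "closed_in W A" using A C unfolding closed_in_def by blast
    then have "C \<subseteq> A" using least True by blast
    then show ?thesis using A(2) by (auto simp: closed_in_def)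
  next
    case False
    have "closed_in W (C - A)" using A C E_sym unfolding closed_in_def by blast
    then have "C \<subseteq> C - A" using least False xC by blast
    then show ?thesis using A by (auto simp: closed_in_def)
  qed
  then have "component W C" using C xC by (auto simp: component_def conn_def)
  then show ?thesis using xC by blast
qed

text \<open>Take \<open>v\<close> so that the component of \<open>x\<close> in
  \<open>C - {v}\<close> is as large as possible. If a vertex \<open>w\<close> were left over,
  deleting \<open>w\<close> instead would keep that component and add \<open>v\<close> to
  it.\<close>

lemma conn_remove_vertex:
  assumes fin: "finite C" and C: "conn C" and x: "x \<in> C" and y: "y \<in> C" "y \<noteq> x"
  shows "\<exists>v\<in>C. v \<noteq> x \<and> conn (C - {v})"
proof -
  define P where "P = (\<lambda>(v, D). v \<in> C \<and> v \<noteq> x \<and> component (C - {v}) D \<and> x \<in> D)"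
  have "\<exists>D. component (C - {y}) D \<and> x \<in> D" using component_ex[of x "C - {y}"] x y by simp
  then obtain D0 where "P (y, D0)" using y by (auto simp: P_def)
  moreover have "\<forall>p. P p \<longrightarrow> card (snd p) < card C + 1"
  proof (intro allI impI)
    fix p assume "P p"
    then have "component (C - {fst p}) (snd p)" by (auto simp: P_def)
    then have "snd p \<subseteq> C" using component_subset by blast
    then show "card (snd p) < card C + 1" using card_mono[OF fin] by (simp add: less_Suc_eq_le)
  qed
  ultimately obtain p where "P p" and max: "\<forall>q. P q \<longrightarrow> card (snd q) \<le> card (snd p)"
    using ex_has_greatest_nat[of P "(y, D0)" "\<lambda>p. card (snd p)" "card C + 1"] by auto
  moreover obtain v D where p: "p = (v, D)" by fastforce
  ultimately have v: "v \<in> C" "v \<noteq> x" and D: "component (C - {v}) D" and xD: "x \<in> D"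
    by (auto simp: P_def)
  have DC: "D \<subseteq> C - {v}" using D component_subset by blast
  have "D = C - {v}"
  proof (rule ccontr)
    assume "D \<noteq> C - {v}"
    then obtain w where w: "w \<in> C" "w \<noteq> v" "w \<notin> D" using DC by blast
    obtain D' where D': "component (C - {w}) D'" "x \<in> D'"
      using component_ex[of x "C - {w}"] x w xD by blast
    have "conn D" using D by (simp add: component_def)
    then have "D \<subseteq> D'"
      using conn_subset_closed[of D "C - {w}" D'] D' DC w xD by (auto simp: component_def)
    \<comment> \<open>Since \<open>C\<close> is connected, some edge leaves \<open>D\<close>, and it
      can only end in \<open>v\<close>.\<close>
    moreover have "v \<in> D'"
    proof (rule ccontr)
      assume vD': "v \<notin> D'"
      have "\<not> closed_in C D" using connD[OF C, of D] xD DC v by blast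
      then obtain a b where ab: "a \<in> D" "b \<in> C" "E a b" "b \<notin> D"
        using DC by (auto simp: closed_in_def)
      then have "b = v" using component_closed[OF D, of a b] by blast
      then show False using component_closed[OF D'(1), of a b] ab w vD' \<open>D \<subseteq> D'\<close> by blast
    qed
    ultimately have "insert v D \<subseteq> D'" by blast
    moreover have "finite D'" using component_subset[OF D'(1)] fin finite_subset by blast
    ultimately have "card (insert v D) \<le> card D'" by (rule card_mono[rotated])
    moreover have "finite D" using DC fin finite_subset by blast
    ultimately have "card D < card D'" using DC by (subst (asm) card_insert_disjoint) auto
    moreover have "P (w, D')" using w D' xD by (auto simp: P_def)
    ultimately show False using max p by fastforce
  qed
  then show ?thesis using v D by (auto simp: component_def)
qed

end

section \<open>Exchanges in maximum free sets\<close>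

text \<open>
  \<open>F\<close> is the family of vertex sets of the copies of \<open>G\<close>, and \<open>d\<close>, \<open>g\<close>, \<open>r\<close> stand for \<open>\<delta>(G)\<close>,
  \<open>|V(G)|\<close> and \<open>(k - 1) \<delta>(G)\<close>. In particular \<open>g = d + 1\<close> says that \<open>G\<close> is complete.
\<close>

locale copy_family = adjacency E for E :: "'v \<Rightarrow> 'v \<Rightarrow> bool" +
  fixes V :: "'v set" and F :: "'v set set" and d g r :: nat
  assumes finite_V: "finite V"
    and F_subset: "X \<in> F \<Longrightarrow> X \<subseteq> V"
    and F_conn: "X \<in> F \<Longrightarrow> conn X"
    and F_card: "X \<in> F \<Longrightarrow> card X = g"
    and F_degree: "X \<in> F \<Longrightarrow> x \<in> X \<Longrightarrow> d \<le> card (nbhd x X)"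
    and d_pos: "1 \<le> d"
    and r_pos: "1 \<le> r"
    and degree_le: "x \<in> V \<Longrightarrow> card (nbhd x V) \<le> r + d"
begin

definition free :: "'v set \<Rightarrow> bool" where
  "free W \<longleftrightarrow> (\<forall>X\<in>F. \<not> X \<subseteq> W)"

definition max_free :: "'v set \<Rightarrow> bool" where
  "max_free S \<longleftrightarrow> S \<subseteq> V \<and> free S \<and> (\<forall>W. W \<subseteq> V \<and> free W \<longrightarrow> card W \<le> card S)"

definition bad :: "'v set \<Rightarrow> 'v set \<Rightarrow> bool" where
  "bad W C \<longleftrightarrow> component W C \<and> (\<forall>x\<in>C. card (nbhd x C) = r) \<and> (g = d + 1 \<or> \<not> clique C)"

definition optimal :: "'v set \<Rightarrow> bool" where
  "optimal S \<longleftrightarrow> max_free S \<and>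
     (\<forall>T. max_free T \<longrightarrow> card {C. bad (V - S) C} \<le> card {C. bad (V - T) C})"

lemma free_subset: "free W \<Longrightarrow> A \<subseteq> W \<Longrightarrow> free A"
  by (auto simp: free_def)

lemma bad_component: "bad W C \<Longrightarrow> component W C"
  by (simp add: bad_def)

lemma bad_degree: "bad W C \<Longrightarrow> x \<in> C \<Longrightarrow> card (nbhd x C) = r"
  by (simp add: bad_def)

lemma finite_sub: "A \<subseteq> V \<Longrightarrow> finite A"
  using finite_V finite_subset by blast

lemma max_free_ex: "\<exists>S. max_free S"
proof -
  have "free {}" using F_conn by (auto simp: free_def conn_def)
  moreover have "\<forall>W. W \<subseteq> V \<and> free W \<longrightarrow> card W < card V + 1"
    using card_mono[OF finite_V] by (simp add: less_Suc_eq_le)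
  ultimately show ?thesis
    using ex_has_greatest_nat[of "\<lambda>W. W \<subseteq> V \<and> free W" "{}" card "card V + 1"]
    by (auto simp: max_free_def)
qed

lemma optimal_ex: "\<exists>S. optimal S"
  using ex_has_least_nat[of max_free _ "\<lambda>S. card {C. bad (V - S) C}"] max_free_ex
  by (auto simp: optimal_def)

lemma optimal_max_free: "optimal S \<Longrightarrow> max_free S"
  by (simp add: optimal_def)

lemma max_free_subset: "max_free S \<Longrightarrow> S \<subseteq> V"
  by (simp add: max_free_def)

text \<open>Maximality forces a copy into \<open>insert v S\<close>, and it must use
  \<open>v\<close> because \<open>S\<close> is free.\<close>

lemma max_free_copy:
  assumes S: "max_free S" and v: "v \<in> V" "v \<notin> S"
  shows "\<exists>X\<in>F. v \<in> X \<and> X \<subseteq> insert v S"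
proof -
  have "card (insert v S) > card S"
    using v finite_sub max_free_subset[OF S] by (simp add: card_insert_disjoint)
  moreover have "insert v S \<subseteq> V" using S v by (simp add: max_free_def)
  ultimately have "\<not> free (insert v S)" using S unfolding max_free_def by (meson not_le)
  then obtain X where "X \<in> F" "X \<subseteq> insert v S" by (auto simp: free_def)
  moreover have "v \<in> X" using S calculation by (auto simp: max_free_def free_def)
  ultimately show ?thesis by blast
qed

lemma max_free_degree:
  assumes S: "max_free S" and v: "v \<in> V" "v \<notin> S"
  shows "d \<le> card (nbhd v S)"
proof -
  obtain X where X: "X \<in> F" "v \<in> X" "X \<subseteq> insert v S" using max_free_copy[OF assms] by blast
  have "nbhd v X \<subseteq> nbhd v S" using X E_irrefl by auto
  moreover have "finite S" using S finite_sub max_free_subset by blast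
  ultimately have "card (nbhd v X) \<le> card (nbhd v S)" by (simp add: card_mono)
  then show ?thesis using F_degree[OF X(1,2)] by simp
qed

lemma degree_split:
  assumes "S \<subseteq> V" "W \<subseteq> V - S" "v \<in> V"
  shows "card (nbhd v S) + card (nbhd v W) \<le> r + d"
proof -
  have "finite S" "finite W" using assms finite_sub by blast+
  then have "card (nbhd v S) + card (nbhd v W) = card (nbhd v (S \<union> W))"
    using assms by (subst card_nbhd_Un) auto
  also have "\<dots> \<le> card (nbhd v V)" using assms finite_V by (intro card_nbhd_mono) auto
  finally show ?thesis using degree_le[OF assms(3)] by simp
qed

lemma max_free_outside_degree:
  assumes "max_free S" "v \<in> V" "v \<notin> S"
  shows "card (nbhd v (V - S)) \<le> r"
  using degree_split[of S "V - S" v] max_free_degree[of S v] max_free_subset[of S] assms by simp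

text \<open>The \<open>r\<close> neighbours in \<open>C\<close> leave at most \<open>d\<close> for
  \<open>S\<close>, while maximality of \<open>S\<close> asks for at least \<open>d\<close>.\<close>

lemma bad_degree_inside:
  assumes S: "max_free S" and C: "bad (V - S) C" and v: "v \<in> C"
  shows "card (nbhd v S) = d"
proof -
  have "C \<subseteq> V - S" using C bad_component component_subset by blast
  then show ?thesis
    using degree_split[of S C v] max_free_degree[of S v] bad_degree[OF C v] v
      max_free_subset[OF S] S by (auto simp: subset_iff)
qed

lemma bad_subset: "bad W C \<Longrightarrow> C \<subseteq> W"
  using bad_component component_subset by blast

text \<open>Of its exactly \<open>d\<close> neighbours in \<open>S\<close>, \<open>v\<close> loses
  \<open>u\<close>, too many for a copy through \<open>v\<close>; so \<open>S'\<close> is free and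
  as large as \<open>S\<close>. A bad component of the new complement that avoids \<open>u\<close>
  was bad before and is not \<open>C\<close>, so minimality of their number forces a new one at
  \<open>u\<close>.\<close>

lemma swap:
  assumes S: "optimal S" and C: "bad (V - S) C" and v: "v \<in> C" and u: "u \<in> S" "E v u"
  defines "S' \<equiv> insert v (S - {u})"
  shows "optimal S'" and "\<exists>C'. bad (V - S') C' \<and> u \<in> C'"
proof -
  have mS: "max_free S" using S optimal_max_free by blast
  have SV: "S \<subseteq> V" using mS max_free_subset by blast
  have finS: "finite S" using SV finite_sub by blast
  have CW: "C \<subseteq> V - S" using C bad_subset by blast
  have S'V: "S' \<subseteq> V" using v CW SV by (auto simp: S'_def)
  have "free S'"
  proof (unfold free_def, intro ballI notI)
    fix X assume X: "X \<in> F" "X \<subseteq> S'"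
    have "v \<in> X"
    proof (rule ccontr)
      assume "v \<notin> X"
      then have "X \<subseteq> S" using X by (auto simp: S'_def)
      then show False using mS X by (auto simp: max_free_def free_def)
    qed
    then have "d \<le> card (nbhd v X)" using F_degree X by blast
    also have "\<dots> \<le> card (nbhd v (S - {u}))"
      using X finS E_irrefl by (intro card_mono) (auto simp: S'_def)
    also have "\<dots> < card (nbhd v S)" using finS u by (intro psubset_card_mono) auto
    finally show False using bad_degree_inside[OF mS C v] by simp
  qed
  moreover have cardS': "card S' = card S"
  proof -
    have "v \<notin> S - {u}" using v CW by auto
    then show ?thesis using card_Suc_Diff1[OF finS u(1)] finS by (simp add: S'_def)
  qed
  ultimately have mS': "max_free S'" using mS S'V by (auto simp: max_free_def)
  have old: "bad (V - S) Z \<and> Z \<noteq> C" if Z: "bad (V - S') Z" "u \<notin> Z" for Z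
  proof -
    have ZW: "Z \<subseteq> V - S'" using Z bad_subset by blast
    have ZS: "Z \<subseteq> V - S" using ZW Z(2) by (auto simp: S'_def)
    \<comment> \<open>Besides its \<open>r\<close> neighbours in \<open>Z\<close>, \<open>z\<close>
      would have \<open>v\<close> as one more neighbour outside \<open>S\<close>, above the bound
      \<open>r\<close>.\<close>
    have "\<not> E z v" if z: "z \<in> Z" for z
    proof
      assume E: "E z v"
      have zV: "z \<in> V" "z \<notin> S" using z ZS by auto
      have finZ: "finite Z" using ZS finite_sub by blast
      have vZ: "v \<notin> Z" using ZW by (auto simp: S'_def)
      have "nbhd z (insert v Z) = insert v (nbhd z Z)" using E by auto
      then have "card (nbhd z (insert v Z)) = r + 1"
        using finZ vZ bad_degree[OF Z(1) z] by (simp add: card_insert_disjoint)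
      moreover have "card (nbhd z (insert v Z)) \<le> card (nbhd z (V - S))"
        using ZS CW v finite_V by (intro card_nbhd_mono) auto
      ultimately show False using max_free_outside_degree[OF mS zV] by simp
    qed
    then have "closed_in (V - S) Z"
      using ZS Z bad_component[OF Z(1)] unfolding component_def closed_in_def S'_def by blast
    moreover have "Z \<noteq> C" using v ZW by (auto simp: S'_def)
    ultimately show ?thesis using Z by (auto simp: bad_def component_def)
  qed
  have fin: "finite {C. bad W C}" if "W \<subseteq> V" for W
  proof (rule finite_subset)
    show "{C. bad W C} \<subseteq> Pow V" using that bad_subset by auto
  qed (simp add: finite_V)
  have card_C: "card ({Z. bad (V - S) Z} - {C}) < card {Z. bad (V - S) Z}"
    using C fin by (intro psubset_card_mono) auto
  have le: "card {Z. bad (V - S) Z} \<le> card {Z. bad (V - S') Z}"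
    using S mS' by (auto simp: optimal_def)
  show ex: "\<exists>C'. bad (V - S') C' \<and> u \<in> C'"
  proof (rule ccontr)
    assume "\<not> ?thesis"
    then have "{Z. bad (V - S') Z} \<subseteq> {Z. bad (V - S) Z} - {C}" using old by blast
    then have "card {Z. bad (V - S') Z} \<le> card ({Z. bad (V - S) Z} - {C})"
      using fin by (intro card_mono) auto
    then show False using le card_C by simp
  qed
  then obtain C' where C': "bad (V - S') C'" "u \<in> C'" by blast
  \<comment> \<open>\<open>C\<close> is lost and only the component of \<open>u\<close> is gained,
    so the number of bad components does not rise.\<close>
  have uniq: "Z = C'" if "bad (V - S') Z" "u \<in> Z" for Z
    using component_eq[of "V - S'" Z C'] that C' bad_component by blast
  have "{Z. bad (V - S') Z} \<subseteq> insert C' ({Z. bad (V - S) Z} - {C})" using old uniq by blast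
  then have "card {Z. bad (V - S') Z} \<le> card (insert C' ({Z. bad (V - S) Z} - {C}))"
    using fin by (intro card_mono) auto
  also have "\<dots> \<le> Suc (card ({Z. bad (V - S) Z} - {C}))" by (rule card_insert_le_m1) simp_all
  also have "\<dots> \<le> card {Z. bad (V - S) Z}" using card_C by simp
  finally have "card {Z. bad (V - S') Z} \<le> card {Z. bad (V - S) Z}" .
  then show "optimal S'" using S mS' unfolding optimal_def by (meson order_trans)
qed

text \<open>Away from \<open>a\<close> and \<open>b\<close> the two neighbourhoods agree, so equal
  sizes mean that \<open>a\<close> and \<open>b\<close> are counted together or not at all.
  Regularity of bad components will supply the equal sizes.\<close>

lemma equal_degree_twin:
  assumes fin: "finite A" "finite B" and deg: "card (nbhd x A) = card (nbhd x B)"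
    and eq: "nbhd x A - {a} = nbhd x B - {b}" and a: "a \<in> A" and b: "b \<in> B"
  shows "E x a \<longleftrightarrow> E x b"
proof -
  have "card (nbhd x A - {a}) = card (nbhd x A) - (if E x a then 1 else 0)"
    using fin a by (auto simp: card_Diff_singleton)
  moreover have "card (nbhd x B - {b}) = card (nbhd x B) - (if E x b then 1 else 0)"
    using fin b by (auto simp: card_Diff_singleton)
  moreover have "E x a \<Longrightarrow> card (nbhd x A) > 0" "E x b \<Longrightarrow> card (nbhd x B) > 0"
    using fin a b by (auto simp: card_gt_0_iff)
  ultimately show ?thesis using deg eq by (auto split: if_splits)
qed

text \<open>After \<open>w\<close> is exchanged with \<open>y\<close>, the edge from
  \<open>y\<close> to \<open>e\<close> draws all of \<open>D\<close> into the new bad component.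
  Each \<open>x\<close> in \<open>D\<close> has \<open>r\<close> neighbours in the old and in the
  new component, and these can differ only in \<open>w\<close> and \<open>y\<close>.\<close>

lemma swap_twin:
  assumes S: "optimal S" and C: "bad (V - S) C" and w: "w \<in> C" and y: "y \<in> S" "E w y"
    and D: "component (C - {w}) D" and e: "e \<in> D" "E y e" and x: "x \<in> D"
  shows "E x w \<longleftrightarrow> E x y"
proof -
  define S' where "S' = insert w (S - {y})"
  obtain C' where C': "bad (V - S') C'" "y \<in> C'" using swap[OF S C w y] by (auto simp: S'_def)
  have CW: "C \<subseteq> V - S" using C bad_subset by blast
  have SV: "S \<subseteq> V" using S optimal_max_free max_free_subset by blast
  have CS': "C - {w} \<subseteq> V - S'" using CW y by (auto simp: S'_def)
  have DC: "D \<subseteq> C - {w}" using D component_subset by blast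
  have cl: "component (V - S') C'" using C' bad_component by blast
  have "e \<in> C'" using component_closed[OF cl, of y e] C' e DC CS' by blast
  then have DC': "D \<subseteq> C'"
    using conn_subset_closed[of D "V - S'" C'] D cl DC CS' e by (auto simp: component_def)
  have C'W: "C' \<subseteq> V - S'" using C' bad_subset by blast
  have "nbhd x C - {w} = nbhd x C' - {y}"
  proof (intro set_eqI iffI)
    fix c assume c: "c \<in> nbhd x C - {w}"
    then have "c \<in> C'" using component_closed[OF cl, of x c] x DC' CS' by auto
    then show "c \<in> nbhd x C' - {y}" using c CW y by auto
  next
    fix c assume c: "c \<in> nbhd x C' - {y}"
    then have "c \<in> V - S" "c \<noteq> w" using C'W by (auto simp: S'_def)
    then show "c \<in> nbhd x C - {w}"
      using component_closed[OF bad_component[OF C], of x c] c x DC by auto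
  qed
  moreover have "finite C" "finite C'" using CW C'W finite_sub by blast+
  moreover have "card (nbhd x C) = r" using bad_degree[OF C, of x] x DC by auto
  moreover have "card (nbhd x C') = r" using bad_degree[OF C'(1), of x] x DC' by auto
  ultimately show ?thesis using equal_degree_twin[of C C' x w y] w C' by simp
qed

end

section \<open>Twins of vertices in bad components\<close>

text \<open>Both assumptions concern complete \<open>G\<close>. There \<open>r = 1\<close> means two
  colours and a single edge, the case settled by paths and even cycles; a clique of
  \<open>r + d + 1\<close> vertices would be all of \<open>H\<close>, against condition (2).\<close>

locale clique_avoiding_family = copy_family E V F d g r
  for E :: "'v \<Rightarrow> 'v \<Rightarrow> bool" and V F d g r +
  assumes r_ne_1: "g = d + 1 \<Longrightarrow> r \<noteq> 1"
    and no_clique: "g = d + 1 \<Longrightarrow> Q \<subseteq> V \<Longrightarrow> clique Q \<Longrightarrow> card Q \<noteq> r + d + 1"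
begin

text \<open>A connected 1-regular set is a single edge, hence a clique; a clique is bad only if
  \<open>g = d + 1\<close>, and then \<open>r = 1\<close> is excluded.\<close>

lemma bad_two_le:
  assumes C: "bad W C" and W: "W \<subseteq> V"
  shows "2 \<le> r"
proof (rule ccontr)
  assume "\<not> 2 \<le> r"
  then have r: "r = 1" using r_pos by simp
  have nclq: "\<not> clique C" using C r_ne_1 r unfolding bad_def by blast
  obtain x where x: "x \<in> C" using C by (auto simp: bad_def component_def conn_def)
  obtain y where y: "nbhd x C = {y}"
    using bad_degree[OF C x] r by (auto simp: card_1_singleton_iff)
  have yC: "y \<in> C" "E x y" using y by (auto simp: set_eq_iff)
  obtain z where z: "nbhd y C = {z}"
    using bad_degree[OF C yC(1)] r by (auto simp: card_1_singleton_iff)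
  have zx: "nbhd y C = {x}" using z x E_sym[OF yC(2)] by (auto simp: set_eq_iff)
  have "closed_in C {x, y}" using x yC y zx by (auto simp: closed_in_def set_eq_iff)
  moreover have "conn C" using C by (simp add: bad_def component_def)
  ultimately have "{x, y} = C" using connD[of C "{x, y}"] by simp
  then have "clique C" using yC(2) E_sym by (auto simp: clique_def)
  then show False using nclq by simp
qed

text \<open>Exchanging \<open>y\<close> with a neighbour \<open>w\<close> of \<open>z\<close> leaves
  \<open>z\<close> and its other neighbours in one component of \<open>C - {w}\<close>, on which
  \<open>w\<close> and \<open>y\<close> must then have the same neighbours. Doing this for every
  \<open>w\<close> makes \<open>z\<close> and its neighbours a clique, which fills
  \<open>C\<close>.\<close>

lemma twin_imp_complete:
  assumes S: "optimal S" and C: "bad (V - S) C" and y: "y \<in> S" and z: "z \<in> C"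
    and eq: "nbhd y (C - {z}) = nbhd z C"
  shows "clique C" and "\<forall>x\<in>C. E y x"
proof -
  have CW: "C \<subseteq> V - S" using C bad_subset by blast
  have finC: "finite C" using CW finite_sub by blast
  have r2: "2 \<le> r" using bad_two_le[OF C] by simp
  define N where "N = nbhd z C"
  have zN: "z \<notin> N" using E_irrefl by (auto simp: N_def)
  have NC: "N \<subseteq> C" by (auto simp: N_def)
  have cardN: "card N = r" using bad_degree[OF C z] by (simp add: N_def)
  have yN: "E y x" if "x \<in> N" for x using that eq by (auto simp: N_def set_eq_iff)
  have comp_z: "\<exists>D. component (C - {w}) D \<and> z \<in> D \<and> N - {w} \<subseteq> D" if w: "w \<in> N" for w
  proof -
    have "z \<in> C - {w}" using w zN z by auto
    then obtain D where D: "component (C - {w}) D" "z \<in> D"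
      using component_ex[of z "C - {w}"] by auto
    have "N - {w} \<subseteq> D"
    proof
      fix x assume "x \<in> N - {w}"
      then show "x \<in> D" using component_closed[OF D(1) D(2), of x] by (auto simp: N_def)
    qed
    then show ?thesis using D by blast
  qed
  \<comment> \<open>As \<open>r\<close> is at least 2, \<open>z\<close> has a second neighbour
    \<open>w'\<close>; through it \<open>y\<close> stays attached to the component of
    \<open>z\<close> when \<open>w\<close> leaves.\<close>
  have Eyz: "E y z"
  proof -
    obtain w where w: "w \<in> N" using cardN r2 by fastforce
    have "\<not> N \<subseteq> {w}" using cardN r2 card_mono[of "{w}" N] by auto
    then obtain w' where w': "w' \<in> N" "w' \<noteq> w" using w by blast
    obtain D where D: "component (C - {w}) D" "z \<in> D" "N - {w} \<subseteq> D" using comp_z[OF w] by blast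
    have "E z w \<longleftrightarrow> E z y"
      using swap_twin[OF S C _ y _ D(1) _ _ D(2), of w'] w w' D(3) yN NC E_sym by blast
    then show ?thesis using w E_sym by (auto simp: N_def)
  qed
  \<comment> \<open>Now \<open>z\<close> itself attaches \<open>y\<close> to the component, and
    \<open>x\<close> is adjacent to \<open>y\<close>, hence also to \<open>w\<close>.\<close>
  have adj: "E x w" if w: "w \<in> N" and x: "x \<in> insert z N" "x \<noteq> w" for x w
  proof -
    obtain D where D: "component (C - {w}) D" "z \<in> D" "N - {w} \<subseteq> D" using comp_z[OF w] by blast
    have xD: "x \<in> D" using D x by blast
    have "E x w \<longleftrightarrow> E x y"
      using swap_twin[OF S C _ y _ D(1) D(2) Eyz xD] w yN NC E_sym by blast
    then show ?thesis using x yN Eyz E_sym by blast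
  qed
  have "closed_in C (insert z N)"
  proof (unfold closed_in_def, intro conjI ballI impI)
    show "insert z N \<subseteq> C" using z NC by blast
    fix w x assume w: "w \<in> insert z N" and x: "x \<in> C" "E w x"
    show "x \<in> insert z N"
    proof (cases "w = z")
      case True
      then show ?thesis using x by (simp add: N_def)
    next
      case False
      then have wN: "w \<in> N" using w by simp
      \<comment> \<open>These are already \<open>r\<close> neighbours of \<open>w\<close>, so
        \<open>w\<close> has no others in \<open>C\<close>.\<close>
      have "insert z N - {w} \<subseteq> nbhd w C"
      proof
        fix x assume x: "x \<in> insert z N - {w}"
        then have "E w x" using adj[OF wN, of x] E_sym by blast
        then show "x \<in> nbhd w C" using x z NC by auto
      qed
      moreover have "card (insert z N - {w}) = card (nbhd w C)"
        using cardN zN wN finC NC bad_degree[OF C, of w] finite_subset[OF NC finC] by auto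
      ultimately have "insert z N - {w} = nbhd w C"
        using finC by (intro card_subset_eq) auto
      then show ?thesis using x by (auto simp: set_eq_iff)
    qed
  qed
  then have CN: "C = insert z N"
    using C connD[of C "insert z N"] by (simp add: bad_def component_def)
  show "clique C" using adj E_sym unfolding CN clique_def by blast
  show "\<forall>x\<in>C. E y x" using yN Eyz CN by blast
qed

text \<open>Now \<open>C\<close> is complete, so \<open>g = d + 1\<close>, and \<open>y\<close> sees
  all of \<open>C\<close>. Each \<open>v\<close> in \<open>C\<close> forms a clique with its
  \<open>d\<close> neighbours in \<open>S\<close>, among them \<open>y\<close>; a degree count at
  \<open>y\<close> makes this neighbourhood the same set \<open>A\<close> for all \<open>v\<close>.
  Then \<open>C \<union> A\<close> is a clique of the forbidden size.\<close>

lemma no_twin: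
  assumes S: "optimal S" and C: "bad (V - S) C" and y: "y \<in> S" and z: "z \<in> C"
    and eq: "nbhd y (C - {z}) = nbhd z C"
  shows False
proof -
  note complete = twin_imp_complete[OF assms]
  have g: "g = d + 1" using C complete by (auto simp: bad_def)
  have mS: "max_free S" using S optimal_max_free by blast
  have SV: "S \<subseteq> V" using mS max_free_subset by blast
  have CW: "C \<subseteq> V - S" using C bad_subset by blast
  have finC: "finite C" and finS: "finite S" using CW SV finite_sub by blast+
  define A where "A = insert y (nbhd y S)"
  have "nbhd z C = C - {z}"
  proof (intro set_eqI iffI)
    fix x assume "x \<in> C - {z}"
    then show "x \<in> nbhd z C" using complete(1) z unfolding clique_def by auto
  qed (use E_irrefl in auto)
  then have cardC: "card C = r + 1" using bad_degree[OF C z] z finC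
    by (metis Suc_eq_plus1 card_Suc_Diff1)
  have split: "nbhd v S = A \<and> clique (nbhd v S) \<and> card (nbhd v S) = d" if v: "v \<in> C" for v
  proof -
    have cd: "card (nbhd v S) = d" using bad_degree_inside[OF mS C v] .
    have vV: "v \<in> V" "v \<notin> S" using v CW by auto
    obtain X where X: "X \<in> F" "v \<in> X" "X \<subseteq> insert v S" using max_free_copy[OF mS vV] by blast
    have finX: "finite X" using F_subset[OF X(1)] finite_sub by blast
    \<comment> \<open>A copy has \<open>d + 1\<close> vertices of degree at least \<open>d\<close>,
      so it is a clique.\<close>
    have full: "nbhd x X = X - {x}" if x: "x \<in> X" for x
    proof (rule card_subset_eq)
      show "nbhd x X \<subseteq> X - {x}" using E_irrefl by auto
      then have "card (nbhd x X) \<le> card (X - {x})" using finX by (intro card_mono) auto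
      then show "card (nbhd x X) = card (X - {x})"
        using F_degree[OF X(1) x] F_card[OF X(1)] g finX x by simp
    qed (use finX in simp)
    have "nbhd v X \<subseteq> nbhd v S" using X E_irrefl by auto
    moreover have "card (nbhd v S) \<le> card (nbhd v X)" using cd F_degree[OF X(1,2)] by simp
    ultimately have "nbhd v X = nbhd v S" using finS by (intro card_seteq) auto
    then have vX: "nbhd v S = X - {v}" using full[OF X(2)] by simp
    have clq: "clique (nbhd v S)"
      unfolding clique_def vX
    proof (intro ballI impI)
      fix a b assume ab: "a \<in> X - {v}" "b \<in> X - {v}" "a \<noteq> b"
      then have "b \<in> nbhd a X" using full[of a] by blast
      then show "E a b" by simp
    qed
    have yv: "y \<in> nbhd v S" using complete(2) v y E_sym by auto
    have sub: "nbhd v S - {y} \<subseteq> nbhd y S"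
    proof
      fix x assume x: "x \<in> nbhd v S - {y}"
      then have "E y x" using clq[unfolded clique_def, rule_format, OF yv, of x] by blast
      then show "x \<in> nbhd y S" using x by simp
    qed
    \<comment> \<open>The \<open>r + 1\<close> neighbours of \<open>y\<close> in \<open>C\<close>
      leave at most \<open>d - 1\<close> in \<open>S\<close>, and the rest of the clique
      \<open>nbhd v S\<close> already supplies that many.\<close>
    have "nbhd y C = C" using complete(2) by auto
    then have "card (nbhd y S) + (r + 1) \<le> r + d"
      using degree_split[OF SV CW, of y] cardC y SV by auto
    then have "card (nbhd y S) \<le> card (nbhd v S - {y})" using cd yv finS by simp
    then have "nbhd v S - {y} = nbhd y S" using sub finS by (intro card_seteq) auto
    then have "nbhd v S = A" using insert_Diff[OF yv] by (metis A_def)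
    then show ?thesis using clq cd by simp
  qed
  have "clique (C \<union> A)"
    unfolding clique_def
  proof (intro ballI impI)
    fix a b assume ab: "a \<in> C \<union> A" "b \<in> C \<union> A" "a \<noteq> b"
    have CA: "E p q" if "p \<in> C" "q \<in> A" for p q using split[OF that(1)] that(2) by auto
    have "clique A" using split[OF z] by metis
    then show "E a b" using ab complete(1) CA E_sym unfolding clique_def by blast
  qed
  moreover have "C \<union> A \<subseteq> V" using CW SV split[OF z] by auto
  moreover have "card (C \<union> A) = r + d + 1"
  proof -
    have "A \<subseteq> S" using split[OF z] by auto
    then have "C \<inter> A = {}" "finite A" using CW finS finite_subset by auto
    moreover have "card A = d" using split[OF z] by metis
    ultimately show ?thesis using cardC finC by (simp add: card_Un_disjoint)
  qed
  ultimately show False using no_clique[OF g] by blast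
qed

text \<open>The configuration that arises when the walk below re-enters a set that it has left.\<close>

lemma no_return:
  assumes S: "optimal S" and C: "bad (V - S) C" and v: "v \<in> C" and u: "u \<in> S"
    and T: "bad W T" "u \<in> T" and RW: "C - {v} \<subseteq> W"
    and conn: "conn (C - {v})" and closed: "closed_in (W - {u}) (C - {v})"
    and meet: "T \<inter> (C - {v}) \<noteq> {}" and W: "W \<subseteq> V"
  shows False
proof -
  have CW: "C \<subseteq> V - S" using C bad_subset by blast
  have TW: "T \<subseteq> W" using T(1) bad_subset by blast
  \<comment> \<open>\<open>C - {v}\<close> is the remnant left behind and \<open>W\<close> the later
    complement: \<open>T\<close> meets the connected remnant, hence swallows it.\<close>
  have RT: "C - {v} \<subseteq> T"
    using conn_subset_closed[OF conn _ RW, of T] bad_component[OF T(1)] meet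
    by (auto simp: component_def)
  have fin: "finite C" "finite T" using CW TW W finite_sub by blast+
  \<comment> \<open>Each \<open>x\<close> in the remnant has degree \<open>r\<close> in
    \<open>C\<close> and in \<open>T\<close>, with \<open>u\<close> taking the place of
    \<open>v\<close>; so \<open>u\<close> is a twin of \<open>v\<close>.\<close>
  have "E x v \<longleftrightarrow> E x u" if x: "x \<in> C - {v}" for x
  proof (rule equal_degree_twin[OF fin])
    show "card (nbhd x C) = card (nbhd x T)"
      using bad_degree[OF C, of x] bad_degree[OF T(1), of x] x RT by auto
    show "nbhd x C - {v} = nbhd x T - {u}"
    proof (intro set_eqI iffI)
      fix c assume "c \<in> nbhd x C - {v}"
      then show "c \<in> nbhd x T - {u}" using RT CW u by auto
    next
      fix c assume "c \<in> nbhd x T - {u}"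
      then have "c \<in> W - {u}" "E x c" using TW by auto
      then show "c \<in> nbhd x C - {v}" using closed_inD[OF closed x, of c] by simp
    qed
  qed (use v T in auto)
  then have uv: "E u x \<longleftrightarrow> E v x" if "x \<in> C - {v}" for x using that E_sym by blast
  have "nbhd u (C - {v}) = nbhd v C"
  proof (intro set_eqI iffI)
    fix x assume "x \<in> nbhd u (C - {v})"
    then show "x \<in> nbhd v C" using uv[of x] by simp
  next
    fix x assume "x \<in> nbhd v C"
    then have "x \<in> C - {v}" "E v x" using E_irrefl by auto
    then show "x \<in> nbhd u (C - {v})" using uv[of x] by simp
  qed
  then show False using no_twin[OF S C u v] by simp
qed

end

section \<open>The walk\<close>

context clique_avoiding_family begin

text \<open>
  A state of the walk: the bad component \<open>C\<close> was created by moving \<open>x\<close> out of the free set, and \<open>U\<close>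
  is the union of the bad components destroyed earlier. The last conjunct records, for every
  vertex of \<open>U\<close> outside \<open>S\<close>, the step at which it was left behind.
\<close>

definition walk_state :: "'v set \<Rightarrow> 'v set \<Rightarrow> 'v \<Rightarrow> 'v set \<Rightarrow> bool" where
  "walk_state S C x U \<longleftrightarrow> optimal S \<and> bad (V - S) C \<and> x \<in> C \<and> U \<subseteq> V \<and> U \<inter> C = {} \<and>
     (\<forall>q\<in>U. nbhd q (V - S) \<subseteq> insert x U) \<and>
     (\<forall>q\<in>U - S. \<exists>S0 C0 v0. optimal S0 \<and> bad (V - S0) C0 \<and> v0 \<in> C0 \<and> q \<in> C0 - {v0} \<and>
        component (V - S) (C0 - {v0}) \<and> C0 \<subseteq> U \<and> S - U \<subseteq> S0)"

text \<open>Move out of \<open>C\<close> by a vertex \<open>v\<close> that is not \<open>x\<close>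
  and leaves \<open>C - {v}\<close> connected. If the new bad component met this remnant or an
  earlier one, it would be a forbidden return; so it avoids \<open>U \<union> C\<close>, which
  becomes the new \<open>U\<close>.\<close>

lemma walk_step:
  assumes st: "walk_state S C x U"
  shows "\<exists>S' C' x' U'. walk_state S' C' x' U' \<and> card U < card U'"
proof -
  have S: "optimal S" and C: "bad (V - S) C" and x: "x \<in> C" and UV: "U \<subseteq> V"
    and disj: "U \<inter> C = {}" using st by (auto simp: walk_state_def)
  have Unb: "c \<in> insert x U" if "q \<in> U" "c \<in> V" "c \<notin> S" "E q c" for q c
  proof -
    have "nbhd q (V - S) \<subseteq> insert x U" using st that(1) unfolding walk_state_def by blast
    then show ?thesis using that by (simp add: subset_iff)
  qed
  have hist: "\<exists>S0 C0 v0. optimal S0 \<and> bad (V - S0) C0 \<and> v0 \<in> C0 \<and> q \<in> C0 - {v0} \<and>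
      component (V - S) (C0 - {v0}) \<and> C0 \<subseteq> U \<and> S - U \<subseteq> S0" if "q \<in> U" "q \<notin> S" for q
    using st that unfolding walk_state_def by blast
  have mS: "max_free S" using S optimal_max_free by blast
  have SV: "S \<subseteq> V" using mS max_free_subset by blast
  have CW: "C \<subseteq> V - S" using C bad_subset by blast
  have finC: "finite C" using CW finite_sub by blast
  have cC: "component (V - S) C" using C bad_component by blast
  have connC: "conn C" using cC by (simp add: component_def)
  have "card (nbhd x C) \<noteq> 0" using bad_degree[OF C x] r_pos by simp
  then obtain y where "y \<in> C" "y \<noteq> x" using E_irrefl by (metis card.empty equals0I in_nbhd)
  then obtain v where v: "v \<in> C" "v \<noteq> x" and connR: "conn (C - {v})"
    using conn_remove_vertex[OF finC connC x] by blast
  have vV: "v \<in> V" "v \<notin> S" using v CW by auto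
  have "card (nbhd v S) \<noteq> 0" using bad_degree_inside[OF mS C v(1)] d_pos by simp
  then obtain u where u: "u \<in> S" "E v u" by (metis card.empty equals0I in_nbhd)
  define S' where "S' = insert v (S - {u})"
  have uV: "u \<in> V" using u SV by auto
  have S': "optimal S'" using swap(1)[OF S C v(1) u] by (simp add: S'_def)
  obtain C' where C': "bad (V - S') C'" "u \<in> C'"
    using swap(2)[OF S C v(1) u] by (auto simp: S'_def)
  have cC': "component (V - S') C'" using C' bad_component by blast
  have C'W: "C' \<subseteq> V - S'" using C' bad_subset by blast
  \<comment> \<open>From \<open>U\<close> the only way to a vertex outside \<open>S\<close> and
    \<open>U\<close> is \<open>x\<close>, so a neighbour \<open>u\<close> in \<open>U\<close>
    contradicts the choice of \<open>v\<close> different from \<open>x\<close>.\<close>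
  have uU: "u \<notin> U"
  proof
    assume "u \<in> U"
    then have "v \<in> insert x U" using Unb[of u v] vV u E_sym by blast
    then show False using v disj by auto
  qed
  have vU: "v \<notin> U" using v disj by auto
  have sub: "c \<in> V - S" "c \<noteq> v" if "c \<in> C'" "c \<noteq> u" for c
    using that C'W by (auto simp: S'_def)
  have outside: "c \<in> V - S" if "c \<in> V - S'" "c \<noteq> u" for c
    using that by (auto simp: S'_def)
  have V_S': "V - S' - {u} = V - S - {v}" using u vV by (auto simp: S'_def)
  have meetC: "C' \<inter> (C - {v}) = {}"
  proof (rule ccontr)
    assume ne: "C' \<inter> (C - {v}) \<noteq> {}"
    have "closed_in (V - S' - {u}) (C - {v})"
      using cC unfolding V_S' component_def closed_in_def by auto
    moreover have "C - {v} \<subseteq> V - S'" using CW by (auto simp: S'_def)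
    ultimately show False
      using no_return[OF S C v(1) u(1) C' _ connR _ ne] by blast
  qed
  have meetU: "C' \<inter> U = {}"
  proof (rule ccontr)
    assume "C' \<inter> U \<noteq> {}"
    then obtain q where q: "q \<in> C'" "q \<in> U" by blast
    then have "q \<noteq> u" using uU by blast
    then have "q \<notin> S" using sub q by blast
    then obtain S0 C0 v0 where o: "optimal S0" "bad (V - S0) C0" "v0 \<in> C0" "q \<in> C0 - {v0}"
      and R: "component (V - S) (C0 - {v0})" and sb: "C0 \<subseteq> U" "S - U \<subseteq> S0"
      using hist[OF q(2)] by blast
    \<comment> \<open>As \<open>u\<close> is fresh, it was in the free set already at the earlier
      step, so the return can be judged from there.\<close>
    have uS0: "u \<in> S0" using u uU sb by blast
    have "C0 - {v0} \<subseteq> V - S" using R component_subset by blast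
    then have RW: "C0 - {v0} \<subseteq> V - S'" using sb vU by (auto simp: S'_def)
    have "C0 - {v0} \<subseteq> V - S' - {u}" using RW sb(1) uU by blast
    then have "closed_in (V - S' - {u}) (C0 - {v0})"
      using R closed_in_subset[of "V - S" "C0 - {v0}"] unfolding V_S' component_def by blast
    moreover have "conn (C0 - {v0})" using R by (simp add: component_def)
    moreover have "C' \<inter> (C0 - {v0}) \<noteq> {}" using q o by blast
    ultimately show False using no_return[OF o(1-3) uS0 C' RW] by blast
  qed
  have "v \<notin> C'" using C'W by (auto simp: S'_def)
  then have disj': "(U \<union> C) \<inter> C' = {}" using meetC meetU by blast
  have "nbhd q (V - S') \<subseteq> insert u (U \<union> C)" if q: "q \<in> U \<union> C" for q
  proof
    fix c assume c: "c \<in> nbhd q (V - S')"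
    show "c \<in> insert u (U \<union> C)"
    proof (cases "c = u")
      case False
      then have cS: "c \<in> V - S" using c outside by simp
      show ?thesis
      proof (cases "q \<in> U")
        case True
        then show ?thesis using Unb[of q c] cS c x by auto
      next
        case False
        then show ?thesis using component_closed[OF cC, of q c] q cS c by auto
      qed
    qed simp
  qed
  moreover have "\<exists>S0 C0 v0. optimal S0 \<and> bad (V - S0) C0 \<and> v0 \<in> C0 \<and> q \<in> C0 - {v0} \<and>
        component (V - S') (C0 - {v0}) \<and> C0 \<subseteq> U \<union> C \<and> S' - (U \<union> C) \<subseteq> S0"
    if q: "q \<in> (U \<union> C) - S'" for q
  proof -
    \<comment> \<open>Remnants remain components: the only vertex that enters the complement is
      \<open>u\<close>, whose neighbours there lie in \<open>C'\<close>, disjoint from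
      \<open>U \<union> C\<close>.\<close>
    have lift: "component (V - S') R"
      if R: "conn R" "closed_in (V - S - {v}) R" "R \<subseteq> U \<union> C" for R
    proof -
      have "b \<in> R" if ab: "a \<in> R" "b \<in> V - S'" "E a b" for a b
      proof (cases "b = u")
        case True
        have "a \<in> V - S'" using R(2) ab(1) unfolding closed_in_def V_S'[symmetric] by auto
        then have "a \<in> C'"
          using component_closed[OF cC' C'(2), of a] ab True E_sym by blast
        then show ?thesis using disj' R(3) ab(1) by blast
      next
        case False
        then show ?thesis using R(2) ab unfolding closed_in_def V_S'[symmetric] by auto
      qed
      moreover have "R \<subseteq> V - S'" using R(2) unfolding closed_in_def V_S'[symmetric] by auto
      ultimately show ?thesis using R(1) by (auto simp: component_def closed_in_def)
    qed
    show ?thesis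
    proof (cases "q \<in> U")
      case True
      then have "q \<notin> S" using q uU by (auto simp: S'_def)
      then obtain S0 C0 v0 where o: "optimal S0" "bad (V - S0) C0" "v0 \<in> C0" "q \<in> C0 - {v0}"
        and R: "component (V - S) (C0 - {v0})" and sb: "C0 \<subseteq> U" "S - U \<subseteq> S0"
        using hist[OF True] by blast
      have "C0 - {v0} \<subseteq> V - S - {v}" using component_subset[OF R] sb(1) vU by blast
      then have "closed_in (V - S - {v}) (C0 - {v0})"
        using R closed_in_subset[of "V - S" "C0 - {v0}"] unfolding component_def by blast
      then have "component (V - S') (C0 - {v0})"
        using lift R sb(1) unfolding component_def by blast
      moreover have "C0 \<subseteq> U \<union> C" using sb by blast
      moreover have "S' - (U \<union> C) \<subseteq> S0" using sb v by (auto simp: S'_def)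
      ultimately show ?thesis using o by blast
    next
      case False
      then have qC: "q \<in> C - {v}" using q by (auto simp: S'_def)
      have "closed_in (V - S - {v}) (C - {v})"
        using cC unfolding component_def closed_in_def by auto
      then have "component (V - S') (C - {v})" using lift connR by blast
      moreover have "S' - (U \<union> C) \<subseteq> S" using v by (auto simp: S'_def)
      ultimately show ?thesis using S C v qC by blast
    qed
  qed
  moreover have "U \<union> C \<subseteq> V" using UV CW by blast
  ultimately have "walk_state S' C' u (U \<union> C)"
    using S' C' disj' unfolding walk_state_def by blast
  moreover have "card U < card (U \<union> C)"
    using x disj UV finC finite_sub by (intro psubset_card_mono) auto
  ultimately show ?thesis by blast
qed

text \<open>A bad component would start a walk whose set \<open>U\<close> grows forever inside the
  finite set \<open>V\<close>.\<close>

lemma optimal_no_bad: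
  assumes S: "optimal S"
  shows "\<not> bad (V - S) C"
proof
  assume C: "bad (V - S) C"
  then obtain x where "x \<in> C" by (auto simp: bad_def component_def conn_def)
  \<comment> \<open>With \<open>U\<close> empty there is no history to record, so any vertex of
    \<open>C\<close> can serve as the entry vertex.\<close>
  then have start: "walk_state S C x {}" using S C by (auto simp: walk_state_def)
  have "\<exists>S C x U. walk_state S C x U \<and> n \<le> card U" for n
  proof (induction n)
    case 0
    then show ?case using start by blast
  next
    case (Suc n)
    then show ?case using walk_step by (meson Suc_leI le_less_trans)
  qed
  then obtain S C x U where "walk_state S C x U" "card V + 1 \<le> card U" by blast
  then show False using card_mono[OF finite_V, of U] by (auto simp: walk_state_def)
qed

section \<open>Greedy colouring of the complement\<close>

text \<open>
  A vertex with fewer than \<open>r = m d\<close> neighbours has fewer than \<open>d\<close> in some colour class. Otherwise it lies in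
  a complete component; then \<open>g > d + 1\<close>, and a class that meets the component in at most \<open>d\<close> other
  vertices can still take it.
\<close>

lemma greedy_coloring:
  assumes r: "r = m * d" and B: "B \<subseteq> V" and deg: "\<And>x. x \<in> B \<Longrightarrow> card (nbhd x B) \<le> r"
    and nbad: "\<And>C. \<not> bad B C" and W: "W \<subseteq> B"
  shows "\<exists>c. c ` W \<subseteq> {1..m} \<and> (\<forall>i. free {x\<in>W. c x = i})"
  using W
\<comment> \<open>Only \<open>W\<close> shrinks; \<open>B\<close> stays fixed, so that the absence
  of bad components is kept.\<close>
proof (induction "card W" arbitrary: W)
  case 0
  then have "W = {}" using B finite_sub by (metis card_0_eq subset_trans)
  moreover have "free {}" using F_conn by (auto simp: free_def conn_def)
  ultimately show ?case by simp
next
  case (Suc n)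
  have finB: "finite B" and finW: "finite W" using B Suc.prems finite_sub by blast+
  have extend: "\<exists>c. c ` W \<subseteq> {1..m} \<and> (\<forall>i. free {x\<in>W. c x = i})"
    if v: "v \<in> W" and
      c: "c ` (W - {v}) \<subseteq> {1..m}" "\<forall>i. free {x\<in>W - {v}. c x = i}" and
      j: "j \<in> {1..m}" "free (insert v {x\<in>W - {v}. c x = j})" for v c j
  proof (intro exI conjI allI)
    show "(c(v := j)) ` W \<subseteq> {1..m}" using c(1) j(1) by auto
    fix i
    show "free {x\<in>W. (c(v := j)) x = i}"
    proof (cases "i = j")
      case True
      have "{x\<in>W. (c(v := j)) x = i} = insert v {x\<in>W - {v}. c x = j}" using v True by auto
      then show ?thesis using j(2) by simp
    next
      case False
      then have "{x\<in>W. (c(v := j)) x = i} = {x\<in>W - {v}. c x = i}" by auto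
      then show ?thesis using c(2) by simp
    qed
  qed
  have IH: "\<exists>c. c ` (W - {v}) \<subseteq> {1..m} \<and> (\<forall>i. free {x\<in>W - {v}. c x = i})" if "v \<in> W" for v
  proof (rule Suc.hyps(1))
    show "n = card (W - {v})" using Suc.hyps(2) that finW by simp
  qed (use Suc.prems in blast)
  have copy: "v \<in> X \<and> d \<le> card (nbhd v A)"
    if X: "X \<in> F" "X \<subseteq> insert v A" and A: "free A" "finite A" for X v A
  proof -
    have v: "v \<in> X" using X A(1) by (auto simp: free_def)
    have "nbhd v X \<subseteq> nbhd v A" using X(2) E_irrefl by auto
    then have "card (nbhd v X) \<le> card (nbhd v A)" using A(2) by (intro card_mono) auto
    then show ?thesis using F_degree[OF X(1) v] v by simp
  qed
  have sum_classes: "(\<Sum>j\<in>{1..m}. card (nbhd v {x\<in>W - {v}. c x = j})) = card (nbhd v W)"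
    if c: "c ` (W - {v}) \<subseteq> {1..m}" for c v
  proof -
    have "x \<noteq> v \<and> c x \<in> {1..m}" if "x \<in> nbhd v W" for x
    proof -
      have "x \<in> W - {v}" using that E_irrefl by auto
      then show ?thesis using c by blast
    qed
    then have "nbhd v W = (\<Union>j\<in>{1..m}. nbhd v {x\<in>W - {v}. c x = j})" by auto
    also have "card \<dots> = (\<Sum>j\<in>{1..m}. card (nbhd v {x\<in>W - {v}. c x = j}))"
      using finW by (intro card_UN_disjoint) auto
    finally show ?thesis by simp
  qed
  show ?case
  proof (cases "\<exists>v\<in>W. card (nbhd v W) < r")
    case True
    then obtain v where v: "v \<in> W" "card (nbhd v W) < r" by blast
    obtain c where c: "c ` (W - {v}) \<subseteq> {1..m}" "\<forall>i. free {x\<in>W - {v}. c x = i}"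
      using IH[OF v(1)] by blast
    \<comment> \<open>With \<open>d\<close> neighbours in each of the \<open>m\<close> classes,
      \<open>v\<close> would have at least \<open>m * d = r\<close> in total.\<close>
    have "\<exists>j\<in>{1..m}. card (nbhd v {x\<in>W - {v}. c x = j}) < d"
    proof (rule ccontr)
      assume "\<not> ?thesis"
      then have "(\<Sum>j\<in>{1..m}. d) \<le> (\<Sum>j\<in>{1..m}. card (nbhd v {x\<in>W - {v}. c x = j}))"
        by (intro sum_mono) (simp add: not_less)
      then show False using sum_classes[OF c(1)] v(2) r by simp
    qed
    then obtain j where j: "j \<in> {1..m}" "card (nbhd v {x\<in>W - {v}. c x = j}) < d" by blast
    have "free (insert v {x\<in>W - {v}. c x = j})"
    proof (unfold free_def, intro ballI notI)
      fix X assume X: "X \<in> F" "X \<subseteq> insert v {x\<in>W - {v}. c x = j}"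
      have "d \<le> card (nbhd v {x\<in>W - {v}. c x = j})" using copy[OF X] c(2) finW by simp
      then show False using j(2) by simp
    qed
    then show ?thesis using extend[OF v(1) c j(1)] by blast
  next
    case False
    \<comment> \<open>All vertices of \<open>W\<close> have \<open>r\<close> neighbours in
      \<open>W\<close>, the most possible in \<open>B\<close>; hence \<open>W\<close> is a union of
      components of \<open>B\<close>.\<close>
    have full: "nbhd x W = nbhd x B" if x: "x \<in> W" for x
    proof (rule card_seteq)
      show "card (nbhd x B) \<le> card (nbhd x W)" using False deg[of x] x Suc.prems by fastforce
    qed (use finB Suc.prems in auto)
    obtain v where v: "v \<in> W" using Suc.hyps(2) by (metis card.empty equals0I nat.distinct(1))
    have "v \<in> B" using v Suc.prems by blast
    then obtain C where C: "component B C" "v \<in> C" using component_ex by blast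
    have CB: "C \<subseteq> B" using C component_subset by blast
    have connC: "conn C" using C by (simp add: component_def)
    have finC: "finite C" using CB finB finite_subset by blast
    have "closed_in B W"
      using full Suc.prems unfolding closed_in_def by (auto simp: set_eq_iff)
    then have CW: "C \<subseteq> W" using conn_subset_closed[OF connC _ CB, of W] C v by blast
    have C_nb: "nbhd x C = nbhd x W" if "x \<in> C" for x
      using that full[of x] component_closed[OF C(1), of x] CW Suc.prems by (auto simp: set_eq_iff)
    have degC: "card (nbhd x C) = r" if x: "x \<in> C" for x
    proof -
      have "x \<in> W" "x \<in> B" using x CW CB by auto
      then have "\<not> card (nbhd x W) < r" "card (nbhd x B) \<le> r" using False deg by auto
      then show ?thesis using C_nb[OF x] full[OF \<open>x \<in> W\<close>] by simp
    qed
    then have g: "g \<noteq> d + 1" and clq: "clique C" using nbad[of C] C(1) by (auto simp: bad_def)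
    obtain c where c: "c ` (W - {v}) \<subseteq> {1..m}" "\<forall>i. free {x\<in>W - {v}. c x = i}"
      using IH[OF v] by blast
    \<comment> \<open>The \<open>m * d\<close> neighbours of \<open>v\<close> cannot exceed
      \<open>d\<close> in every class.\<close>
    have "\<exists>j\<in>{1..m}. card (nbhd v {x\<in>W - {v}. c x = j}) \<le> d"
    proof (rule ccontr)
      assume "\<not> ?thesis"
      then have "(\<Sum>j\<in>{1..m}. d) < (\<Sum>j\<in>{1..m}. card (nbhd v {x\<in>W - {v}. c x = j}))"
        using r r_pos by (intro sum_strict_mono) (auto simp: not_le)
      then show False using sum_classes[OF c(1)] degC[OF C(2)] C_nb[OF C(2)] r by simp
    qed
    then obtain j where j: "j \<in> {1..m}" "card (nbhd v {x\<in>W - {v}. c x = j}) \<le> d" by blast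
    have "free (insert v {x\<in>W - {v}. c x = j})"
    proof (unfold free_def, intro ballI notI)
      fix X assume X: "X \<in> F" "X \<subseteq> insert v {x\<in>W - {v}. c x = j}"
      have vX: "v \<in> X" using copy[OF X] c(2) finW by simp
      have XW: "X \<subseteq> W" using X(2) v by blast
      \<comment> \<open>A copy through \<open>v\<close> is connected and stays in the clique
        \<open>C\<close>, so it consists of \<open>v\<close> and at most \<open>d\<close>
        neighbours. The degree bound then forces \<open>g = d + 1\<close>, which was ruled
        out.\<close>
      have "X \<subseteq> C"
        using conn_subset_closed[OF F_conn[OF X(1)], of B C] C XW Suc.prems vX
        unfolding component_def by blast
      then have "X - {v} \<subseteq> nbhd v {x\<in>W - {v}. c x = j}"
        using X(2) cliqueD[OF clq C(2)] by (auto simp: subset_iff)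
      then have "card (X - {v}) \<le> card (nbhd v {x\<in>W - {v}. c x = j})"
        using finW by (intro card_mono) auto
      then have "card (X - {v}) \<le> d" using j(2) by simp
      moreover have finX: "finite X" using XW finW finite_subset by blast
      ultimately have "g \<le> d + 1" using F_card[OF X(1)] vX by simp
      moreover have "d \<le> card (X - {v})"
        using F_degree[OF X(1) vX] card_mono[of "X - {v}" "nbhd v X"] finX E_irrefl by fastforce
      ultimately show False using F_card[OF X(1)] vX finX g d_pos by simp
    qed
    then show ?thesis using extend[OF v c j(1)] by blast
  qed
qed

theorem coloring_with_max_free_class:
  assumes r: "r = m * d"
  shows "\<exists>c. c ` V \<subseteq> {1..m + 1} \<and> (\<forall>i. free {x\<in>V. c x = i}) \<and> max_free {x\<in>V. c x = m + 1}"
proof -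
  obtain S where S: "optimal S" using optimal_ex by blast
  have mS: "max_free S" using S optimal_max_free by blast
  obtain c where c: "c ` (V - S) \<subseteq> {1..m}" "\<forall>i. free {x\<in>V - S. c x = i}"
    using greedy_coloring[OF r, of "V - S" "V - S"] max_free_outside_degree[OF mS]
      optimal_no_bad[OF S] by auto
  \<comment> \<open>The greedy colours end at \<open>m\<close>, so \<open>m + 1\<close> is reserved
    for \<open>S\<close>.\<close>
  define c' where "c' = (\<lambda>x. if x \<in> S then m + 1 else c x)"
  have "c' ` V \<subseteq> {1..m + 1}" using c(1) by (fastforce simp: c'_def)
  moreover have top: "{x\<in>V. c' x = m + 1} = S"
  proof (intro set_eqI iffI)
    fix x assume x: "x \<in> {x\<in>V. c' x = m + 1}"
    have "c x \<le> m" if "x \<notin> S" using c(1) that x by (auto simp: image_subset_iff)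
    then show "x \<in> S" using x by (cases "x \<in> S") (auto simp: c'_def)
  qed (use max_free_subset[OF mS] in \<open>auto simp: c'_def\<close>)
  moreover have "free {x\<in>V. c' x = i}" for i
  proof (cases "i = m + 1")
    case True
    then show ?thesis using top mS by (simp add: max_free_def)
  next
    case False
    then have "{x\<in>V. c' x = i} \<subseteq> {x\<in>V - S. c x = i}" by (auto simp: c'_def)
    then show ?thesis using c(2) free_subset by blast
  qed
  ultimately show ?thesis using mS by auto
qed

end

section \<open>Connected graphs of maximum degree two\<close>

context adjacency
begin

lemma three_neighbours:
  assumes "finite V" "{a, b, c} \<subseteq> V" "a \<noteq> b" "a \<noteq> c" "b \<noteq> c" "E x a" "E x b" "E x c"
  shows "2 < card (nbhd x V)"
proof -
  have "card {a, b, c} \<le> card (nbhd x V)" using assms by (intro card_mono) auto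
  then show ?thesis using assms by simp
qed

text \<open>A longest path works: an inner vertex has used up both its neighbours and an end vertex
  cannot be extended, so no edge leaves the path. The same count leaves the two ends as the only
  possible chord.\<close>

lemma spanning_path:
  assumes fin: "finite V" and conn: "conn V" and deg: "\<And>x. x \<in> V \<Longrightarrow> card (nbhd x V) \<le> 2"
  shows "\<exists>p. distinct p \<and> set p = V \<and> (\<forall>i. Suc i < length p \<longrightarrow> E (p ! i) (p ! Suc i)) \<and>
    (\<forall>i j. i < j \<longrightarrow> j < length p \<longrightarrow> E (p ! i) (p ! j) \<longrightarrow> j = Suc i \<or> i = 0 \<and> Suc j = length p)"
proof -
  define P where "P p \<longleftrightarrow> p \<noteq> [] \<and> distinct p \<and> set p \<subseteq> V \<and>
    (\<forall>i. Suc i < length p \<longrightarrow> E (p ! i) (p ! Suc i))" for p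
  obtain x where "x \<in> V" using conn by (auto simp: conn_def)
  then have "P [x]" by (auto simp: P_def)
  moreover have "\<forall>p. P p \<longrightarrow> length p < card V + 1"
  proof (intro allI impI)
    fix p assume "P p"
    then have "card (set p) \<le> card V" "distinct p" using fin by (auto simp: P_def intro: card_mono)
    then show "length p < card V + 1" by (simp add: distinct_card)
  qed
  ultimately obtain p where p: "P p" and max: "\<forall>q. P q \<longrightarrow> length q \<le> length p"
    using ex_has_greatest_nat[of P "[x]" length "card V + 1"] by auto
  have dist: "distinct p" and pV: "set p \<subseteq> V" and ne: "p \<noteq> []" using p by (auto simp: P_def)
  have step: "E (p ! i) (p ! Suc i)" if "Suc i < length p" for i using p that by (simp add: P_def)
  have in_V: "p ! i \<in> V" if "i < length p" for i using that pV nth_mem by blast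
  have neq: "p ! i \<noteq> p ! j" if "i < length p" "j < length p" "i \<noteq> j" for i j
    using dist that by (simp add: nth_eq_iff_index_eq)
  have only: "y = p ! (i - 1) \<or> y = p ! Suc i"
    if i: "0 < i" "Suc i < length p" and y: "y \<in> V" "E (p ! i) y" for i y
  proof (rule ccontr)
    assume "\<not> ?thesis"
    moreover have "E (p ! i) (p ! (i - 1))" using step[of "i - 1"] i E_sym by simp
    moreover have "p ! (i - 1) \<noteq> p ! Suc i" using neq[of "i - 1" "Suc i"] i by simp
    ultimately have "2 < card (nbhd (p ! i) V)"
      using i y step[of i] in_V[of "i - 1"] in_V[of "Suc i"]
      by (intro three_neighbours[OF fin, of "p ! (i - 1)" "p ! Suc i" y]) auto
    then show False using deg[of "p ! i"] in_V[of i] i by simp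
  qed
  have "closed_in V (set p)"
  proof (unfold closed_in_def, intro conjI ballI impI)
    fix x y assume x: "x \<in> set p" and y: "y \<in> V" and xy: "E x y"
    obtain i where i: "i < length p" "x = p ! i" using x by (auto simp: in_set_conv_nth)
    show "y \<in> set p"
    proof (rule ccontr)
      assume yp: "y \<notin> set p"
      consider "i = 0" | "Suc i = length p" | "0 < i" "Suc i < length p" using i by linarith
      then show False
      proof cases
        case 1
        have "P (y # p)"
          using p y yp xy i 1 E_sym ne by (auto simp: P_def nth_Cons split: nat.split)
        then show False using max by fastforce
      next
        case 2
        have "E ((p @ [y]) ! j) ((p @ [y]) ! Suc j)" if "Suc j < length (p @ [y])" for j
        proof (cases "Suc j < length p")
          case True
          then show ?thesis using step by (simp add: nth_append)
        next
          case False
          then have "j = i" using that 2 by simp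
          then show ?thesis using xy i 2 by (simp add: nth_append)
        qed
        then have "P (p @ [y])" using p y yp by (simp add: P_def)
        then show False using max by fastforce
      next
        case 3
        then show False using only[OF 3 y] xy i yp by (metis nth_mem less_imp_diff_less)
      qed
    qed
  qed (use pV in auto)
  then have "set p = V" using connD[OF conn, of "set p"] ne by simp
  moreover have "j = Suc i \<or> i = 0 \<and> Suc j = length p"
    if ij: "i < j" "j < length p" "E (p ! i) (p ! j)" for i j
  proof (cases "0 < i")
    case True
    then have "p ! j = p ! (i - 1) \<or> p ! j = p ! Suc i"
      using only[of i "p ! j"] ij in_V[of j] by simp
    moreover have "p ! j \<noteq> p ! (i - 1)" using neq[of j "i - 1"] ij by simp
    moreover have "j = Suc i" if "p ! j = p ! Suc i" using neq[of j "Suc i"] ij that by auto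
    ultimately show ?thesis by blast
  next
    case False
    show ?thesis
    proof (cases "Suc j = length p")
      case True
      then show ?thesis using \<open>\<not> 0 < i\<close> by simp
    next
      case False
      then have "p ! i = p ! (j - 1) \<or> p ! i = p ! Suc j"
        using only[of j "p ! i"] ij in_V[of i] E_sym by simp
      moreover have "p ! i \<noteq> p ! Suc j" using neq[of i "Suc j"] ij False by simp
      moreover have "j = Suc i" if "p ! i = p ! (j - 1)"
      proof -
        have "i = j - 1" using neq[of i "j - 1"] ij that by fastforce
        then show ?thesis using ij by simp
      qed
      ultimately show ?thesis by blast
    qed
  qed
  ultimately show ?thesis using dist step by blast
qed

text \<open>Colour by parity of the position. An independent set has at most one vertex in each pair
  of positions \<open>2t\<close>, \<open>2t + 1\<close>, and each such pair contains an even
  position.\<close>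

lemma parity_coloring:
  assumes p: "distinct p" "\<And>i. Suc i < length p \<Longrightarrow> E (p ! i) (p ! Suc i)"
    and chord: "\<And>i j. i < j \<Longrightarrow> j < length p \<Longrightarrow> E (p ! i) (p ! j) \<Longrightarrow> odd (i + j)"
  shows "\<exists>c. c ` set p \<subseteq> {1..2::nat} \<and>
    (\<forall>i. \<forall>x\<in>{x\<in>set p. c x = i}. \<forall>y\<in>{x\<in>set p. c x = i}. \<not> E x y) \<and>
    (\<forall>W \<subseteq> set p. (\<forall>x\<in>W. \<forall>y\<in>W. \<not> E x y) \<longrightarrow> card W \<le> card {x\<in>set p. c x = 1})"
proof -
  define n where "n = length p"
  \<comment> \<open>Positions start at 0, so the even ones are never outnumbered and colour 1 is the
    larger class.\<close>
  define c :: "'v \<Rightarrow> nat" where "c x = (if \<exists>i<n. even i \<and> p ! i = x then 1 else 2)" for x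
  have c_nth: "c (p ! i) = (if even i then 1 else 2)" if "i < n" for i
    using that p(1) by (auto simp: c_def n_def nth_eq_iff_index_eq)
  have set_p: "\<exists>i<n. x = p ! i" if "x \<in> set p" for x
    using that by (auto simp: in_set_conv_nth n_def)
  have odd_sum: "odd (i + j)" if "i < n" "j < n" "E (p ! i) (p ! j)" for i j
  proof -
    have "i \<noteq> j" using that E_irrefl by metis
    then consider "i < j" | "j < i" by linarith
    then show ?thesis
    proof cases
      case 1
      then show ?thesis using chord[of i j] that by (simp add: n_def)
    next
      case 2
      then show ?thesis using chord[of j i] that E_sym by (simp add: n_def add.commute)
    qed
  qed
  have indep: "\<not> E x y" if xy: "x \<in> set p" "y \<in> set p" "c x = c y" for x y
  proof
    assume E: "E x y"
    obtain i j where ij: "i < n" "j < n" "x = p ! i" "y = p ! j" using xy set_p by metis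
    then have "even i \<longleftrightarrow> even j" using xy(3) c_nth by (auto split: if_splits)
    then show False using odd_sum[of i j] ij E by simp
  qed
  have max: "card W \<le> card {x\<in>set p. c x = 1}"
    if W: "W \<subseteq> set p" "\<forall>x\<in>W. \<forall>y\<in>W. \<not> E x y" for W
  proof -
    define I where "I = {i. i < n \<and> p ! i \<in> W}"
    have WI: "W = (!) p ` I" using W(1) set_p by (auto simp: I_def)
    \<comment> \<open>Each position goes to the even member of its pair; two positions with the same
      image would be consecutive, hence adjacent.\<close>
    have "inj_on (\<lambda>i. p ! (2 * (i div 2))) I"
    proof (rule inj_onI)
      fix i j assume ij: "i \<in> I" "j \<in> I" and eq: "p ! (2 * (i div 2)) = p ! (2 * (j div 2))"
      have "2 * (i div 2) = 2 * (j div 2)"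
        using eq ij p(1) by (subst (asm) nth_eq_iff_index_eq) (auto simp: I_def n_def)
      then have "i \<le> Suc j" "j \<le> Suc i" by linarith+
      then have "i = j \<or> j = Suc i \<or> i = Suc j" by linarith
      moreover have ij': "i < length p" "j < length p" "\<not> E (p ! i) (p ! j)" "\<not> E (p ! j) (p ! i)"
        using W(2) ij by (simp_all add: I_def n_def)
      moreover have "j \<noteq> Suc i" using p(2)[of i] ij' by blast
      moreover have "i \<noteq> Suc j" using p(2)[of j] ij' by blast
      ultimately show "i = j" by blast
    qed
    moreover have "(\<lambda>i. p ! (2 * (i div 2))) ` I \<subseteq> {x\<in>set p. c x = 1}"
    proof
      fix x assume "x \<in> (\<lambda>i. p ! (2 * (i div 2))) ` I"
      then obtain i where i: "i < n" "x = p ! (2 * (i div 2))" by (auto simp: I_def)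
      then have "2 * (i div 2) < n" by linarith
      then show "x \<in> {x\<in>set p. c x = 1}" using c_nth[of "2 * (i div 2)"] i by (simp add: n_def)
    qed
    ultimately have "card I \<le> card {x\<in>set p. c x = 1}" by (intro card_inj_on_le) auto
    moreover have "card W \<le> card I" unfolding WI by (intro card_image_le) (simp add: I_def)
    ultimately show ?thesis by simp
  qed
  show ?thesis
  proof (intro exI[of _ c] conjI allI impI ballI)
    show "c ` set p \<subseteq> {1..2}" by (simp add: c_def image_subset_iff)
    fix i x y assume "x \<in> {x\<in>set p. c x = i}" "y \<in> {x\<in>set p. c x = i}"
    then show "\<not> E x y" using indep[of x y] by simp
  qed (rule max)
qed

end

section \<open>Copies of a graph\<close>

abbreviation adj :: "'a pair_pre_digraph \<Rightarrow> 'a \<Rightarrow> 'a \<Rightarrow> bool" where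
  "adj H x y \<equiv> (x, y) \<in> parcs H"

text \<open>Arcs are preserved but not reflected, since the subgraphs in question need not be
  induced.\<close>

definition embedding :: "'a pair_pre_digraph \<Rightarrow> 'b pair_pre_digraph \<Rightarrow> ('a \<Rightarrow> 'b) \<Rightarrow> bool" where
  "embedding G H f \<longleftrightarrow> inj_on f (pverts G) \<and> f ` pverts G \<subseteq> pverts H \<and>
     (\<forall>a b. adj G a b \<longrightarrow> adj H (f a) (f b))"

definition copies :: "'a pair_pre_digraph \<Rightarrow> 'b pair_pre_digraph \<Rightarrow> 'b set set" where
  "copies G H = {f ` pverts G | f. embedding G H f}"

lemma embeddingD:
  assumes "embedding G H f"
  shows "inj_on f (pverts G)" and "f ` pverts G \<subseteq> pverts H"
    and "adj G a b \<Longrightarrow> adj H (f a) (f b)"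
  using assms by (auto simp: embedding_def)

lemma adjacency_adj:
  assumes "pair_graph H"
  shows "adjacency (adj H)"
proof -
  interpret pair_graph H by fact
  show ?thesis
    by unfold_locales (auto dest: arcs_symmetric no_loops')
qed

text \<open>Isomorphisms of digraphs carry a separate arc map. In a subgraph of a pair graph, tail
  and head are the projections, so the vertex map determines it; conversely
  \<open>map_prod f f\<close> turns an embedding into an isomorphism onto its image.\<close>

lemma graph_free_induced_iff:
  assumes G: "pair_graph G" and H: "pair_graph H" and W: "W \<subseteq> pverts H"
  shows "graph_free (with_proj G) (with_proj H \<restriction> W) \<longleftrightarrow> (\<forall>X\<in>copies G H. \<not> X \<subseteq> W)"
proof -
  interpret G: pair_graph G by fact
  interpret H: pair_graph H by fact
  have wfHW: "wf_digraph (with_proj H \<restriction> W)" by (rule H.wellformed_induce_subgraph)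
  have "\<exists>X\<in>copies G H. X \<subseteq> W"
    if S: "subgraph S (with_proj H \<restriction> W)" and iso: "digraph_iso (with_proj G) S" for S
  proof -
    obtain h where h: "G.digraph_isomorphism h" and S_eq: "S = app_iso h (with_proj G)"
      using iso by (auto simp: digraph_iso_def)
    define f where "f = iso_verts h"
    have proj: "tail S = fst" "head S = snd"
      using S by (auto simp: subgraph_def compatible_def induce_subgraph_def)
    have vS: "f ` pverts G \<subseteq> W" using S by (auto simp: S_eq f_def subgraph_def)
    have "adj H (f a) (f b)" if ab: "adj G a b" for a b
    proof -
      have "fst (iso_arcs h (a, b)) = f a" "snd (iso_arcs h (a, b)) = f b"
        using h ab proj by (auto simp: G.digraph_isomorphism_def S_eq f_def)
      moreover have "iso_arcs h (a, b) \<in> parcs H"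
        using S ab by (auto simp: S_eq subgraph_def induce_subgraph_def)
      ultimately show ?thesis by (metis prod.collapse)
    qed
    moreover have "inj_on f (pverts G)" using h by (auto simp: G.digraph_isomorphism_def f_def)
    ultimately have "f ` pverts G \<in> copies G H"
      using vS W unfolding copies_def embedding_def by blast
    then show ?thesis using vS by blast
  qed
  moreover have "\<exists>S. subgraph S (with_proj H \<restriction> W) \<and> digraph_iso (with_proj G) S"
    if X: "X \<in> copies G H" "X \<subseteq> W" for X
  proof -
    obtain f where f0: "X = f ` pverts G" "embedding G H f"
      using X(1) by (auto simp: copies_def)
    note f = f0(1) embeddingD[OF f0(2)]
    define h where "h = \<lparr>iso_verts = f, iso_arcs = map_prod f f, iso_head = snd, iso_tail = fst\<rparr>"
    define S where "S = app_iso h (with_proj G)"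
    have "inj_on (map_prod f f) (parcs G)"
      by (rule inj_on_subset[OF map_prod_inj_on[OF f(2) f(2)]]) (auto dest: G.wellformed')
    then have h: "G.digraph_isomorphism h"
      using f(2) G.wf_digraph by (auto simp: G.digraph_isomorphism_def h_def)
    have "wf_digraph S"
      unfolding S_def using h by (rule G.wf_digraphI_app_iso)
    then have "subgraph S (with_proj H \<restriction> W)"
      using wfHW X(2) f(1,4) G.wellformed'
      by (auto simp: subgraph_def compatible_def S_def h_def induce_subgraph_def)
    moreover have "digraph_iso (with_proj G) S" using h by (auto simp: digraph_iso_def S_def)
    ultimately show ?thesis by blast
  qed
  ultimately show ?thesis unfolding graph_free_def by blast
qed

lemma digraph_isoI:
  assumes A: "pair_wf_digraph A" and B: "pair_wf_digraph B"
    and f: "bij_betw f (pverts A) (pverts B)"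
    and arcs: "\<And>a b. a \<in> pverts A \<Longrightarrow> b \<in> pverts A \<Longrightarrow> adj A a b \<longleftrightarrow> adj B (f a) (f b)"
  shows "digraph_iso (with_proj A) (with_proj B)"
proof -
  interpret A: pair_wf_digraph A by fact
  interpret B: pair_wf_digraph B by fact
  define h where "h = \<lparr>iso_verts = f, iso_arcs = map_prod f f, iso_head = snd, iso_tail = fst\<rparr>"
  have inj: "inj_on f (pverts A)" and img: "f ` pverts A = pverts B"
    using f by (auto simp: bij_betw_def)
  have "inj_on (map_prod f f) (parcs A)"
    by (rule inj_on_subset[OF map_prod_inj_on[OF inj inj]]) (auto dest: A.wellformed')
  then have "A.digraph_isomorphism h"
    using inj A.wf_digraph by (auto simp: A.digraph_isomorphism_def h_def)
  moreover have "map_prod f f ` parcs A = parcs B"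
  proof (intro equalityI subsetI)
    fix e assume "e \<in> parcs B"
    then obtain x y where e: "e = (x, y)" "adj B x y" by (cases e) auto
    then obtain a b where ab: "a \<in> pverts A" "b \<in> pverts A" "x = f a" "y = f b"
      using img B.wellformed' by (metis imageE)
    then have "adj A a b" using arcs e by simp
    then show "e \<in> map_prod f f ` parcs A" using ab e by force
  next
    fix e assume "e \<in> map_prod f f ` parcs A"
    then obtain a b where "adj A a b" "e = (f a, f b)" by auto
    then show "e \<in> parcs B" using arcs A.wellformed' by metis
  qed
  then have "with_proj B = app_iso h (with_proj A)"
    using img by (simp add: app_iso_def h_def with_proj_def)
  ultimately show ?thesis unfolding digraph_iso_def by blast
qed

section \<open>Degrees and connectivity of copies\<close>

lemma out_degree_eq:
  assumes "pair_graph H"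
  shows "out_degree (with_proj H) v = card (adjacency.nbhd (adj H) v (pverts H))"
proof -
  interpret H: pair_graph H by fact
  interpret E: adjacency "adj H" using adjacency_adj[OF assms] .
  have "E.nbhd v (pverts H) = {w. adj H v w}" by (auto dest: H.wellformed')
  then have "out_arcs (with_proj H) v = Pair v ` E.nbhd v (pverts H)"
    by (auto simp: out_arcs_def)
  then show ?thesis by (simp add: out_degree_def card_image inj_on_def)
qed

lemma min_degree_le:
  assumes "pair_graph G" "v \<in> pverts G"
  shows "min_degree (with_proj G) \<le> out_degree (with_proj G) v"
proof -
  interpret pair_graph G by fact
  show ?thesis unfolding min_degree_def using assms(2) pair_finite_verts by (intro Min_le) auto
qed

lemma max_degree_ge:
  assumes "pair_graph G" "v \<in> pverts G"
  shows "out_degree (with_proj G) v \<le> max_degree (with_proj G)"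
proof -
  interpret pair_graph G by fact
  show ?thesis unfolding max_degree_def using assms(2) pair_finite_verts by (intro Max_ge) auto
qed

text \<open>A closed set contains all that is reachable from it, and symmetrizing adds no arcs to a
  symmetric graph.\<close>

lemma conn_connected:
  assumes G: "pair_graph G" and c: "Digraph_Component.connected (with_proj G)"
  shows "adjacency.conn (adj G) (pverts G)"
proof -
  interpret G: pair_graph G by fact
  interpret E: adjacency "adj G" using adjacency_adj[OF G] .
  have arcs: "parcs (mk_symmetric (with_proj G)) = parcs G"
    using G.adj_mk_symmetric_eq[OF G.pair_sym_arcs] by simp
  have sc: "strongly_connected (with_proj (mk_symmetric (with_proj G)))"
    using c by (simp add: Digraph_Component.connected_def)
  have "A = pverts G" if A: "A \<noteq> {}" "E.closed_in (pverts G) A" for A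
  proof
    show "A \<subseteq> pverts G" using A by (auto simp: E.closed_in_def)
    obtain x where x: "x \<in> A" using A by blast
    show "pverts G \<subseteq> A"
    proof
      fix y assume y: "y \<in> pverts G"
      have "x \<in> pverts G" using x A by (auto simp: E.closed_in_def)
      then have "(x, y) \<in> rtrancl_on (pverts G) (parcs G)"
        using sc y by (auto simp: strongly_connected_def reachable_def arcs)
      then show "y \<in> A"
        by (induction rule: rtrancl_on_induct) (auto intro: x E.closed_inD[OF A(2)])
    qed
  qed
  moreover have "pverts G \<noteq> {}" using sc by (auto simp: strongly_connected_def)
  ultimately show ?thesis by (auto simp: E.conn_def)
qed

text \<open>The preimage of a closed subset of the copy is closed in \<open>G\<close>.\<close>

lemma copies_conn:
  assumes G: "pair_graph G" and c: "Digraph_Component.connected (with_proj G)"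
    and H: "pair_graph H" and X: "X \<in> copies G H"
  shows "adjacency.conn (adj H) X"
proof -
  interpret G: pair_graph G by fact
  interpret EG: adjacency "adj G" using adjacency_adj[OF G] .
  interpret EH: adjacency "adj H" using adjacency_adj[OF H] .
  obtain f where f0: "X = f ` pverts G" "embedding G H f"
    using X by (auto simp: copies_def)
  note f = f0(1) embeddingD[OF f0(2)]
  have conn: "EG.conn (pverts G)" using conn_connected[OF G c] .
  have "A = X" if A: "A \<noteq> {}" "EH.closed_in X A" for A
  proof -
    define B where "B = {a \<in> pverts G. f a \<in> A}"
    have AX: "A \<subseteq> X" using A(2) by (simp add: EH.closed_in_def)
    have "EG.closed_in (pverts G) B"
      unfolding EG.closed_in_def
    proof (intro conjI ballI impI)
      fix a b assume "a \<in> B" "b \<in> pverts G" "adj G a b"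
      then show "b \<in> B" using EH.closed_inD[OF A(2), of "f a" "f b"] f by (simp add: B_def)
    qed (auto simp: B_def)
    moreover have "B \<noteq> {}" using A AX f(1) by (auto simp: B_def)
    ultimately have "B = pverts G" using EG.connD[OF conn] by blast
    then have "X \<subseteq> A" using f(1) by (auto simp: B_def)
    then show ?thesis using AX by blast
  qed
  then show ?thesis using f(1) conn by (auto simp: EH.conn_def EG.conn_def)
qed

lemma copies_degree:
  assumes G: "pair_graph G" and H: "pair_graph H" and f: "inj_on f (pverts G)"
    "\<And>a b. adj G a b \<Longrightarrow> adj H (f a) (f b)" and a: "a \<in> pverts G"
  shows "f ` adjacency.nbhd (adj G) a (pverts G)
      \<subseteq> adjacency.nbhd (adj H) (f a) (f ` pverts G)"
    and "card (f ` adjacency.nbhd (adj G) a (pverts G)) = out_degree (with_proj G) a"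
proof -
  interpret EG: adjacency "adj G" using adjacency_adj[OF G] .
  interpret EH: adjacency "adj H" using adjacency_adj[OF H] .
  show "f ` EG.nbhd a (pverts G) \<subseteq> EH.nbhd (f a) (f ` pverts G)" using f(2) by auto
  have "inj_on f (EG.nbhd a (pverts G))" using f(1) by (rule inj_on_subset) auto
  then show "card (f ` EG.nbhd a (pverts G)) = out_degree (with_proj G) a"
    using out_degree_eq[OF G] by (simp add: card_image)
qed

lemma copies_min_degree:
  assumes G: "pair_graph G" and H: "pair_graph H" and X: "X \<in> copies G H" and x: "x \<in> X"
  shows "min_degree (with_proj G) \<le> card (adjacency.nbhd (adj H) x X)"
proof -
  interpret G: pair_graph G by fact
  interpret EH: adjacency "adj H" using adjacency_adj[OF H] .
  obtain f where f0: "X = f ` pverts G" "embedding G H f"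
    using X by (auto simp: copies_def)
  note f = f0(1) embeddingD[OF f0(2)]
  obtain a where a: "a \<in> pverts G" "x = f a" using x f(1) by blast
  have "finite X" using f(1) G.pair_finite_verts by simp
  then have "out_degree (with_proj G) a \<le> card (EH.nbhd x X)"
    using copies_degree[OF G H f(2,4) a(1)] a(2) f(1) by (metis EH.finite_nbhd card_mono)
  then show ?thesis using min_degree_le[OF G a(1)] by simp
qed

text \<open>This settles the case of one colour. Degrees in \<open>G\<close> are at least, and
  degrees in \<open>H\<close> at most, \<open>min_degree\<close>, so the embedding maps
  neighbourhoods onto neighbourhoods; no edge leaves the copy, which is therefore all of
  \<open>H\<close>.\<close>

lemma copy_imp_iso:
  assumes G: "pair_graph G" and H: "pair_graph H"
    and conn: "Digraph_Component.connected (with_proj H)"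
    and Gne: "pverts G \<noteq> {}"
    and deg: "max_degree (with_proj H) \<le> min_degree (with_proj G)" and X: "X \<in> copies G H"
  shows "regular_graph (with_proj G)" and "digraph_iso (with_proj H) (with_proj G)"
proof -
  interpret G: pair_graph G by fact
  interpret H: pair_graph H by fact
  interpret EG: adjacency "adj G" using adjacency_adj[OF G] .
  interpret EH: adjacency "adj H" using adjacency_adj[OF H] .
  obtain f where f0: "X = f ` pverts G" "embedding G H f"
    using X by (auto simp: copies_def)
  note f = f0(1) embeddingD[OF f0(2)]
  have nb: "f ` EG.nbhd a (pverts G) = EH.nbhd (f a) (pverts H)
      \<and> out_degree (with_proj G) a = min_degree (with_proj G)" if a: "a \<in> pverts G" for a
  proof -
    have fa: "f a \<in> pverts H" using f(3) a by blast
    have sub: "f ` EG.nbhd a (pverts G) \<subseteq> EH.nbhd (f a) (pverts H)"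
    proof
      fix y assume "y \<in> f ` EG.nbhd a (pverts G)"
      then obtain b where "b \<in> pverts G" "adj G a b" "y = f b" by auto
      then show "y \<in> EH.nbhd (f a) (pverts H)" using f(3) f(4)[of a b] by auto
    qed
    have fin: "finite (EH.nbhd (f a) (pverts H))" using H.pair_finite_verts by simp
    have "card (EH.nbhd (f a) (pverts H)) \<le> min_degree (with_proj G)"
      using max_degree_ge[OF H fa] out_degree_eq[OF H, of "f a"] deg by simp
    moreover note min_degree_le[OF G a] copies_degree(2)[OF G H f(2,4) a] card_mono[OF fin sub]
    ultimately show ?thesis using card_seteq[OF fin sub] by linarith
  qed
  show "regular_graph (with_proj G)" unfolding regular_graph_def using nb by auto
  have "EH.closed_in (pverts H) X"
    unfolding EH.closed_in_def
  proof (intro conjI ballI impI)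
    show "X \<subseteq> pverts H" using f by simp
    fix x y assume "x \<in> X" and y: "y \<in> pverts H" "adj H x y"
    then obtain a where a: "a \<in> pverts G" "x = f a" using f(1) by blast
    then have "y \<in> f ` EG.nbhd a (pverts G)" using nb y by simp
    then show "y \<in> X" using f(1) by auto
  qed
  then have XH: "X = pverts H"
    using EH.connD[OF conn_connected[OF H conn], of X] f(1) Gne by simp
  then have bij: "bij_betw f (pverts G) (pverts H)" using f by (simp add: bij_betw_def)
  \<comment> \<open>Condition (1) speaks of an isomorphism from \<open>H\<close> to
    \<open>G\<close>, so the embedding is inverted.\<close>
  define h where "h = the_inv_into (pverts G) f"
  have bij': "bij_betw h (pverts H) (pverts G)"
    unfolding h_def using bij by (rule bij_betw_the_inv_into)
  have fh: "f (h x) = x" if "x \<in> pverts H" for x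
    using f_the_inv_into_f_bij_betw[OF bij that] by (simp add: h_def)
  show "digraph_iso (with_proj H) (with_proj G)"
  proof (rule digraph_isoI[OF _ _ bij'])
    fix x y assume xy: "x \<in> pverts H" "y \<in> pverts H"
    then have hG: "h x \<in> pverts G" "h y \<in> pverts G" using bij' by (auto simp: bij_betw_def)
    show "adj H x y \<longleftrightarrow> adj G (h x) (h y)"
    proof
      assume "adj H x y"
      then have "y \<in> f ` EG.nbhd (h x) (pverts G)" using nb[OF hG(1)] fh xy by simp
      then obtain b where b: "b \<in> pverts G" "adj G (h x) b" "y = f b" by auto
      then have "h y = b" using f(2) by (simp add: h_def the_inv_into_f_f)
      then show "adj G (h x) (h y)" using b by simp
    next
      assume "adj G (h x) (h y)"
      then show "adj H x y" using f(4)[of "h x" "h y"] fh xy by simp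
    qed
  qed unfold_locales
qed

section \<open>Recognizing complete graphs\<close>

lemma complete_of_all_adj:
  assumes G: "pair_graph G" and card: "card (pverts G) = n"
    and all: "\<And>a b. a \<in> pverts G \<Longrightarrow> b \<in> pverts G \<Longrightarrow> a \<noteq> b \<Longrightarrow> adj G a b"
  shows "K\<^bsub>n\<^esub> (with_proj G)"
proof -
  interpret G: pair_graph G by fact
  have "parcs G = {(u, v). (u, v) \<in> pverts G \<times> pverts G \<and> u \<noteq> v}"
  proof (intro equalityI subsetI)
    fix e assume "e \<in> parcs G"
    then show "e \<in> {(u, v). (u, v) \<in> pverts G \<times> pverts G \<and> u \<noteq> v}"
      using G.no_loops' G.in_arcsD1 G.in_arcsD2 by (cases e) auto
  next
    fix e assume "e \<in> {(u, v). (u, v) \<in> pverts G \<times> pverts G \<and> u \<noteq> v}"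
    then show "e \<in> parcs G" using all by (cases e) simp
  qed
  then show ?thesis using card G.pair_finite_verts by (simp add: complete_digraph_pair_def)
qed

lemma complete_of_min_degree:
  assumes G: "pair_graph G" and card: "card (pverts G) = min_degree (with_proj G) + 1"
  shows "K\<^bsub>min_degree (with_proj G) + 1\<^esub> (with_proj G)"
proof -
  interpret G: pair_graph G by fact
  interpret EG: adjacency "adj G" using adjacency_adj[OF G] .
  have full: "EG.nbhd a (pverts G) = pverts G - {a}" if a: "a \<in> pverts G" for a
  proof (rule card_seteq)
    show "EG.nbhd a (pverts G) \<subseteq> pverts G - {a}" using EG.E_irrefl by auto
    show "card (pverts G - {a}) \<le> card (EG.nbhd a (pverts G))"
      using min_degree_le[OF G a] out_degree_eq[OF G, of a] card a G.pair_finite_verts by simp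
  qed (simp add: G.pair_finite_verts)
  have "adj G a b" if "a \<in> pverts G" "b \<in> pverts G" "a \<noteq> b" for a b
  proof -
    have "b \<in> EG.nbhd a (pverts G)" using full that by simp
    then show ?thesis by simp
  qed
  then show ?thesis using complete_of_all_adj[OF G card] by blast
qed

text \<open>Vertices of \<open>Q\<close> have exhausted their degree inside \<open>Q\<close>, so no
  edge leaves it and connectedness makes it all of \<open>H\<close>.\<close>

lemma complete_of_clique:
  assumes H: "pair_graph H" and conn: "Digraph_Component.connected (with_proj H)"
    and deg: "max_degree (with_proj H) \<le> n"
    and Q: "Q \<subseteq> pverts H" "adjacency.clique (adj H) Q" "card Q = n + 1"
  shows "K\<^bsub>n + 1\<^esub> (with_proj H)"
proof -
  interpret H: pair_graph H by fact
  interpret EH: adjacency "adj H" using adjacency_adj[OF H] .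
  have finQ: "finite Q" using Q(3) by (simp add: card_ge_0_finite)
  have nb: "Q - {x} = EH.nbhd x (pverts H)" if x: "x \<in> Q" for x
  proof (rule card_seteq)
    show "Q - {x} \<subseteq> EH.nbhd x (pverts H)"
    proof
      fix y assume "y \<in> Q - {x}"
      then show "y \<in> EH.nbhd x (pverts H)" using EH.cliqueD[OF Q(2) x, of y] Q(1) by auto
    qed
    show "card (EH.nbhd x (pverts H)) \<le> card (Q - {x})"
      using max_degree_ge[OF H, of x] out_degree_eq[OF H, of x] deg Q x finQ by auto
  qed (simp add: H.pair_finite_verts)
  have "EH.closed_in (pverts H) Q"
    unfolding EH.closed_in_def
  proof (intro conjI ballI impI)
    fix x y assume "x \<in> Q" "y \<in> pverts H" "adj H x y"
    then show "y \<in> Q" using nb[of x] by (auto simp: set_eq_iff)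
  qed (rule Q(1))
  moreover have "Q \<noteq> {}" using Q(3) by auto
  ultimately have "Q = pverts H" using EH.connD[OF conn_connected[OF H conn]] by blast
  then show ?thesis using complete_of_all_adj[OF H, of "n + 1"] Q(2,3) EH.cliqueD by blast
qed

section \<open>Two colours when \<open>G\<close> is a single edge\<close>

lemma odd_cycleI:
  assumes H: "pair_graph H" and p: "distinct p" "set p = pverts H" and len: "odd (length p)" "3 \<le> length p"
    and step: "\<And>i. Suc i < length p \<Longrightarrow> adj H (p ! i) (p ! Suc i)"
    and closing: "adj H (p ! 0) (p ! (length p - 1))"
    and chord: "\<And>i j. i < j \<Longrightarrow> j < length p \<Longrightarrow> adj H (p ! i) (p ! j) \<Longrightarrow>
      j = Suc i \<or> i = 0 \<and> Suc j = length p"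
  shows "odd_cycle (with_proj H)"
proof -
  interpret H: pair_graph H by fact
  define n where "n = length p"
  define C where "C = cycle_graph n"
  have n3: "3 \<le> n" using len by (simp add: n_def)
  have C: "adj C i j \<longleftrightarrow> i < n \<and> j < n \<and> (j = (i + 1) mod n \<or> i = (j + 1) mod n)" for i j
    by (simp add: C_def cycle_graph_def)
  have VC: "pverts C = {0..<n}" by (simp add: C_def cycle_graph_def)
  have suc: "(i + 1) mod n = (if i + 1 = n then 0 else i + 1)" if "i < n" for i
    using that by auto
  have fwd: "adj H (p ! i) (p ! j)" if "i < n" "j = (i + 1) mod n" for i j
  proof (cases "i + 1 = n")
    case True
    then have "i = length p - 1" "j = 0" using that(2) by (auto simp: n_def)
    then show ?thesis using closing H.arcs_symmetric by simp
  next
    case False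
    then have "j = Suc i" "Suc i < length p" using that suc[of i] by (auto simp: n_def)
    then show ?thesis using step by simp
  qed
  have bwd: "j = (i + 1) mod n \<or> i = (j + 1) mod n"
    if "i < j" "j < n" "adj H (p ! i) (p ! j)" for i j
    using chord[of i j] that suc[of i] suc[of j] by (auto simp: n_def)
  have "digraph_iso (with_proj C) (with_proj H)"
  proof (rule digraph_isoI)
    show "pair_wf_digraph C" by unfold_locales (auto simp: VC C_def cycle_graph_def)
    show "pair_wf_digraph H" by unfold_locales
    show "bij_betw ((!) p) (pverts C) (pverts H)"
      using bij_betw_nth[of p "{0..<n}" "pverts H"] p by (simp add: VC n_def atLeast0LessThan)
    fix i j assume "i \<in> pverts C" "j \<in> pverts C"
    then have ij: "i < n" "j < n" by (auto simp: VC)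
    show "adj C i j \<longleftrightarrow> adj H (p ! i) (p ! j)"
    proof
      assume "adj C i j"
      then show "adj H (p ! i) (p ! j)" using fwd[of i j] fwd[of j i] C ij H.arcs_symmetric by blast
    next
      assume E: "adj H (p ! i) (p ! j)"
      then have "i \<noteq> j" using H.no_loops' by metis
      then consider "i < j" | "j < i" by linarith
      then show "adj C i j"
        using bwd[of i j] bwd[of j i] E H.arcs_symmetric[OF E] ij by cases (auto simp: C)
    qed
  qed
  then show ?thesis unfolding odd_cycle_def C_def using n3 len n_def by blast
qed

lemma independent_two_coloring:
  assumes H: "pair_graph H" and conn: "Digraph_Component.connected (with_proj H)"
    and deg: "max_degree (with_proj H) \<le> 2" and odd: "\<not> odd_cycle (with_proj H)"
  shows "\<exists>c. c ` pverts H \<subseteq> {1..2::nat} \<and>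
    (\<forall>i. \<forall>x\<in>{x\<in>pverts H. c x = i}. \<forall>y\<in>{x\<in>pverts H. c x = i}. \<not> adj H x y) \<and>
    (\<forall>W \<subseteq> pverts H. (\<forall>x\<in>W. \<forall>y\<in>W. \<not> adj H x y) \<longrightarrow> card W \<le> card {x\<in>pverts H. c x = 1})"
proof -
  interpret H: pair_graph H by fact
  interpret E: adjacency "adj H" using adjacency_adj[OF H] .
  have "card (E.nbhd x (pverts H)) \<le> 2" if "x \<in> pverts H" for x
    using max_degree_ge[OF H that] out_degree_eq[OF H, of x] deg by simp
  then obtain p where p: "distinct p" "set p = pverts H"
    and step: "\<And>i. Suc i < length p \<Longrightarrow> adj H (p ! i) (p ! Suc i)"
    and chord: "\<And>i j. i < j \<Longrightarrow> j < length p \<Longrightarrow> adj H (p ! i) (p ! j) \<Longrightarrow>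
      j = Suc i \<or> i = 0 \<and> Suc j = length p"
    using E.spanning_path[OF H.pair_finite_verts conn_connected[OF H conn]] by metis
  \<comment> \<open>An edge between positions of equal parity can only be the closing edge, and it
    would make the path an odd cycle.\<close>
  have "odd (i + j)" if ij: "i < j" "j < length p" "adj H (p ! i) (p ! j)" for i j
  proof (rule ccontr)
    assume ev: "\<not> odd (i + j)"
    then have "j \<noteq> Suc i" by auto
    then have 0: "i = 0" "Suc j = length p" using chord[OF ij] by auto
    then have "odd (length p)" using ev by (metis add_0 even_Suc)
    moreover have "3 \<le> length p" using 0 ij(1) ev \<open>j \<noteq> Suc i\<close> by linarith
    moreover have "adj H (p ! 0) (p ! (length p - 1))" using ij(3) 0 by (metis diff_Suc_1)
    ultimately have "odd_cycle (with_proj H)" using odd_cycleI[OF H p _ _ step _ chord] by blast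
    then show False using odd by simp
  qed
  then show ?thesis using E.parity_coloring[OF p(1) step] unfolding p(2) by blast
qed

text \<open>Here \<open>G\<close> is a single edge, so being free means being independent.\<close>

lemma copies_two:
  assumes G: "pair_graph G" and card: "card (pverts G) = 2"
    and deg: "min_degree (with_proj G) = 1" and H: "pair_graph H"
  shows "(\<forall>X\<in>copies G H. \<not> X \<subseteq> W) \<longleftrightarrow> (\<forall>x\<in>W. \<forall>y\<in>W. \<not> adj H x y)"
proof -
  interpret G: pair_graph G by fact
  interpret H: pair_graph H by fact
  interpret EH: adjacency "adj H" using adjacency_adj[OF H] .
  have edge: "\<exists>x\<in>W. \<exists>y\<in>W. adj H x y" if X: "X \<in> copies G H" "X \<subseteq> W" for X
  proof -
    obtain f where "X = f ` pverts G" using X by (auto simp: copies_def)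
    moreover have "pverts G \<noteq> {}" using card by auto
    ultimately obtain x where x: "x \<in> X" by blast
    then have "card (EH.nbhd x X) \<noteq> 0" using copies_min_degree[OF G H X(1) x] deg by simp
    then obtain y where "y \<in> EH.nbhd x X" by (metis card.empty equals0I)
    then show ?thesis using x X(2) by auto
  qed
  have copy: "\<exists>X\<in>copies G H. X \<subseteq> W" if xy: "x \<in> W" "y \<in> W" "adj H x y" for x y
  proof -
    obtain a b where ab: "pverts G = {a, b}" "a \<noteq> b" using card by (auto simp: card_2_iff)
    define f where "f v = (if v = a then x else y)" for v
    have "x \<noteq> y" using xy(3) H.no_loops' by blast
    then have "inj_on f (pverts G)" using ab by (auto simp: f_def inj_on_def)
    moreover have "f ` pverts G = {x, y}" using ab by (auto simp: f_def)
    moreover have "adj H (f u) (f v)" if "adj G u v" for u v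
    proof -
      have "u \<noteq> v" "u \<in> {a, b}" "v \<in> {a, b}" using that G.no_loops' G.wellformed' ab(1) by auto
      then show ?thesis using ab(2) xy(3) H.arcs_symmetric[OF xy(3)] by (auto simp: f_def)
    qed
    moreover have "{x, y} \<subseteq> pverts H" using xy(3) H.wellformed' by auto
    ultimately have "embedding G H f" by (simp add: embedding_def)
    then have "f ` pverts G \<in> copies G H" unfolding copies_def by blast
    then have "{x, y} \<in> copies G H" using \<open>f ` pverts G = {x, y}\<close> by simp
    then show ?thesis using xy by (intro bexI[of _ "{x, y}"]) simp_all
  qed
  show ?thesis
  proof (intro iffI ballI notI)
    fix x y assume "\<forall>X\<in>copies G H. \<not> X \<subseteq> W" "x \<in> W" "y \<in> W" "adj H x y"
    then show False using copy[of x y] by simp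
  next
    fix X assume "\<forall>x\<in>W. \<forall>y\<in>W. \<not> adj H x y" "X \<in> copies G H" "X \<subseteq> W"
    then show False using edge[of X] by simp
  qed
qed

section \<open>Assembling the colouring\<close>

theorem coloring_exists:
  fixes G :: "'a pair_pre_digraph" and H :: "'b pair_pre_digraph"
  assumes G: "pair_graph G" and G_conn: "Digraph_Component.connected (with_proj G)"
    and \<delta>: "1 \<le> min_degree (with_proj G)"
    and H: "pair_graph H" and H_conn: "Digraph_Component.connected (with_proj H)"
    and k: "1 \<le> k" and deg: "max_degree (with_proj H) \<le> k * min_degree (with_proj G)"
    and cond1: "regular_graph (with_proj G) \<Longrightarrow> \<not> digraph_iso (with_proj H) (with_proj G)"
    and cond2: "K\<^bsub>min_degree (with_proj G) + 1\<^esub> (with_proj G) \<Longrightarrow>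
      \<not> K\<^bsub>k * min_degree (with_proj G) + 1\<^esub> (with_proj H)"
    and cond3: "K\<^bsub>2\<^esub> (with_proj G) \<Longrightarrow> \<not> odd_cycle (with_proj H)"
  shows "\<exists>c. free_coloring (with_proj G) (with_proj H) k c \<and>
    (\<exists>i\<in>{1..k}. maximum_free_set (with_proj G) (with_proj H) (color_class (with_proj H) c i))"
proof -
  interpret G: pair_graph G by fact
  interpret H: pair_graph H by fact
  interpret EH: adjacency "adj H" using adjacency_adj[OF H] .
  define d where "d = min_degree (with_proj G)"
  define g where "g = card (pverts G)"
  define fr where "fr W \<longleftrightarrow> (\<forall>X\<in>copies G H. \<not> X \<subseteq> W)" for W
  have Gne: "pverts G \<noteq> {}" using conn_connected[OF G G_conn]
    by (simp add: adjacency.conn_def[OF adjacency_adj[OF G]])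
  have complete_G: "K\<^bsub>d + 1\<^esub> (with_proj G)" if "g = d + 1"
    using complete_of_min_degree[OF G] that by (simp add: d_def g_def)
  have goal: ?thesis
    if c: "c ` pverts H \<subseteq> {1..k}" "\<And>i. fr {x\<in>pverts H. c x = i}" and j: "j \<in> {1..k}"
      and max: "\<And>W. W \<subseteq> pverts H \<Longrightarrow> fr W \<Longrightarrow> card W \<le> card {x\<in>pverts H. c x = j}" for c j
  proof (intro exI[of _ c] conjI bexI[of _ j])
    have free: "graph_free (with_proj G) (with_proj H \<restriction> W) \<longleftrightarrow> fr W" if "W \<subseteq> pverts H" for W
      using graph_free_induced_iff[OF G H that] by (simp add: fr_def)
    show "free_coloring (with_proj G) (with_proj H) k c"
      using c free by (auto simp: free_coloring_def color_class_def)
    show "maximum_free_set (with_proj G) (with_proj H) (color_class (with_proj H) c j)"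
      using c free max by (auto simp: maximum_free_set_def color_class_def)
  qed (rule j)
  \<comment> \<open>Two colours with a single edge are set apart because there
    \<open>g = d + 1\<close> and \<open>r = 1\<close>, which the exchange argument excludes.\<close>
  consider "k = 1" | "k = 2" "d = 1" "g = 2" | "2 \<le> k" "\<not> (k = 2 \<and> d = 1 \<and> g = 2)"
    using k by linarith
  then show ?thesis
  proof cases
    case 1
    have no_copy: "X \<notin> copies G H" for X
      using copy_imp_iso[OF G H H_conn Gne, of X] deg cond1 1 by auto
    show ?thesis
    proof (rule goal[of "\<lambda>_. 1" 1])
      fix W assume "W \<subseteq> pverts H"
      then show "card W \<le> card {x\<in>pverts H. 1 = (1::nat)}"
        using H.pair_finite_verts by (simp add: card_mono)
    qed (use no_copy 1 in \<open>auto simp: fr_def\<close>)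
  next
    case 2
    have "K\<^bsub>2\<^esub> (with_proj G)" using complete_G 2 by (simp add: numeral_2_eq_2)
    then have "\<not> odd_cycle (with_proj H)" by (rule cond3)
    moreover have "max_degree (with_proj H) \<le> 2" using deg 2 by (simp add: d_def)
    ultimately have "\<exists>c. c ` pverts H \<subseteq> {1..2::nat} \<and>
        (\<forall>i. \<forall>x\<in>{x\<in>pverts H. c x = i}. \<forall>y\<in>{x\<in>pverts H. c x = i}. \<not> adj H x y) \<and>
        (\<forall>W \<subseteq> pverts H. (\<forall>x\<in>W. \<forall>y\<in>W. \<not> adj H x y) \<longrightarrow>
          card W \<le> card {x\<in>pverts H. c x = 1})"
      using independent_two_coloring[OF H H_conn] by simp
    moreover have "(\<forall>x\<in>W. \<forall>y\<in>W. \<not> adj H x y) \<longleftrightarrow> fr W" for W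
      using copies_two[OF G _ _ H, of W] 2 by (simp add: fr_def d_def g_def)
    ultimately obtain c where "c ` pverts H \<subseteq> {1..2::nat}" "\<forall>i. fr {x\<in>pverts H. c x = i}"
      "\<forall>W \<subseteq> pverts H. fr W \<longrightarrow> card W \<le> card {x\<in>pverts H. c x = 1}"
      by (simp only:) blast
    then show ?thesis using 2(1) by (intro goal[of c 1]) auto
  next
    case 3
    \<comment> \<open>One colour goes to the maximum free set and \<open>m\<close> remain for its
      complement; \<open>m * d\<close> plays the part of \<open>r\<close>, so \<open>r + d\<close>
      is the degree bound \<open>k * d\<close>.\<close>
    define m where "m = k - 1"
    have km: "k = m + 1" "1 \<le> m" using 3 by (auto simp: m_def)
    have mdd: "m * d + d = k * d" using km by simp
    interpret clique_avoiding_family "adj H" "pverts H" "copies G H" d g "m * d"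
    proof unfold_locales
      fix X assume X: "X \<in> copies G H"
      then obtain f where f: "X = f ` pverts G" "embedding G H f" by (auto simp: copies_def)
      show "X \<subseteq> pverts H" using f by (simp add: embedding_def)
      show "EH.conn X" using copies_conn[OF G G_conn H X] .
      show "card X = g" using f by (simp add: g_def embedding_def card_image)
      fix x assume "x \<in> X"
      then show "d \<le> card (EH.nbhd x X)" using copies_min_degree[OF G H X] by (simp add: d_def)
    next
      fix x assume "x \<in> pverts H"
      then show "card (EH.nbhd x (pverts H)) \<le> m * d + d"
        using max_degree_ge[OF H, of x] out_degree_eq[OF H, of x] deg mdd by (simp add: d_def)
    next
      assume "g = d + 1"
      then show "m * d \<noteq> 1" using 3 km by auto
    next
      fix Q assume g: "g = d + 1" and Q: "Q \<subseteq> pverts H" "EH.clique Q"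
      show "card Q \<noteq> m * d + d + 1"
      proof
        assume "card Q = m * d + d + 1"
        then have "K\<^bsub>k * d + 1\<^esub> (with_proj H)"
          using complete_of_clique[OF H H_conn _ Q, of "k * d"] deg mdd by (simp add: d_def)
        then show False using cond2 complete_G[OF g] by (simp add: d_def)
      qed
    qed (use \<delta> km in \<open>auto simp: d_def H.pair_finite_verts\<close>)
    have fr: "fr W \<longleftrightarrow> free W" for W by (simp add: fr_def free_def)
    obtain c where "c ` pverts H \<subseteq> {1..m + 1}" "\<forall>i. free {x\<in>pverts H. c x = i}"
      "max_free {x\<in>pverts H. c x = m + 1}"
      using coloring_with_max_free_class[OF refl] by blast
    then show ?thesis
      using km by (intro goal[of c "m + 1"]) (auto simp: fr max_free_def)
  qed
qed

theorem corollary2: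
  fixes G :: "'a pair_pre_digraph" and H :: "'b pair_pre_digraph"
  assumes G_graph: "pair_graph G"
    and G_connected: "Digraph_Component.connected (with_proj G)"
    and G_min_degree: "min_degree (with_proj G) \<ge> 1"
    and H_graph: "pair_graph H"
    and H_connected: "Digraph_Component.connected (with_proj H)"
    and H_nontrivial: "max_degree (with_proj H) \<ge> 1"
    and cond1: "regular_graph (with_proj G) \<Longrightarrow> \<not> digraph_iso (with_proj H) (with_proj G)"
    and cond2: "K\<^bsub>min_degree (with_proj G) + 1\<^esub> (with_proj G) \<Longrightarrow>
      \<forall>k::nat. k \<ge> 1 \<longrightarrow> \<not> K\<^bsub>k * min_degree (with_proj G) + 1\<^esub> (with_proj H)"
    and cond3: "K\<^bsub>2\<^esub> (with_proj G) \<Longrightarrow>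
      \<not> odd_cycle (with_proj H) \<and> \<not> (\<exists>n. K\<^bsub>n\<^esub> (with_proj H))"
  shows "(\<exists>c. free_coloring (with_proj G) (with_proj H)
            (nat \<lceil>real (max_degree (with_proj H)) / real (min_degree (with_proj G))\<rceil>) c \<and>
          (\<exists>i \<in> {1..nat \<lceil>real (max_degree (with_proj H)) / real (min_degree (with_proj G))\<rceil>}.
            maximum_free_set (with_proj G) (with_proj H) (color_class (with_proj H) c i)))
    \<and> int (free_chromatic_number (with_proj G) (with_proj H))
        \<le> \<lceil>real (max_degree (with_proj H)) / real (min_degree (with_proj G))\<rceil>"
proof -
  define D where "D = max_degree (with_proj H)"
  define d where "d = min_degree (with_proj G)"
  \<comment> \<open>The edge in \<open>H\<close> makes the ceiling positive, so \<open>nat\<close>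
    changes nothing and there is at least one colour.\<close>
  define k where "k = nat \<lceil>real D / real d\<rceil>"
  have d: "0 < d" and D: "0 < D" using G_min_degree H_nontrivial by (simp_all add: d_def D_def)
  then have pos: "0 < \<lceil>real D / real d\<rceil>" by simp
  then have k1: "1 \<le> k" unfolding k_def by linarith
  have "real D / real d \<le> real k" using pos unfolding k_def by linarith
  then have "real D \<le> real (k * d)" using d by (simp add: pos_divide_le_eq)
  then have deg: "D \<le> k * d" by (simp only: of_nat_le_iff)
  have "\<exists>c. free_coloring (with_proj G) (with_proj H) k c \<and>
      (\<exists>i\<in>{1..k}. maximum_free_set (with_proj G) (with_proj H) (color_class (with_proj H) c i))"
    using coloring_exists[OF G_graph G_connected G_min_degree H_graph H_connected k1] deg
      cond1 cond2 cond3 k1 unfolding d_def D_def by blast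
  moreover from this have "free_chromatic_number (with_proj G) (with_proj H) \<le> k"
    unfolding free_chromatic_number_def by (blast intro: Least_le)
  then have "int (free_chromatic_number (with_proj G) (with_proj H)) \<le> \<lceil>real D / real d\<rceil>"
    using pos unfolding k_def by linarith
  ultimately show ?thesis unfolding k_def D_def d_def by blast
qed

end
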